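(* Let $H_0(x)=\sum_{n\ge0}\left|\mathcal{S}^2_n(321)\right|x^n$ be the generating function of $321$-avoiding binary shrub forests (with constant term $1$ for the empty forest). Then $H_0(x)$ is a root of the polynomial $$\begin{aligned}&(4x^2+4x+1)-(x^4-24x^3+8x^2-54x+1)H_0^2+(15x^4+24x^3-71x^2-54x)H_0^4+(18x^5-215x^4+2x^3-360x^2)H_0^6\\&+(3x^6-228x^5-213x^4+162x^3+729x^2)H_0^8-(138x^6-354x^5-1053x^4)H_0^{10}-(36x^7-751x^6-486x^5)H_0^{12}\\&-(3x^8-420x^7-54x^6)H_0^{14}+123x^8H_0^{16}+18x^9H_0^{18}+x^{10}H_0^{20}.\end{aligned}$$ Consequently, the growth rate $\lim_{n\to\infty}\left|\mathcal{S}^2_n(321)\right|^{1/n}$ of $321$-avoiding binary shrub forests equals the greatest real root of $729x^4-28674x^3-15505x^2-25758x+621$, approximately $39.88873$.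
   Context: $\mathcal{S}^2_n(321)$ denotes the set of permutations $\pi\in\mathcal{S}_{3n}$ that avoid $321$ (no indices $a<b<c$ with $\pi_a>\pi_b>\pi_c$) and satisfy $\pi_{3i+1}<\pi_{3i+2}$ and $\pi_{3i+1}<\pi_{3i+3}$ for all $0\le i<n$. *)

theory Defs
  imports
    Complex_Main
    "HOL-Combinatorics.Permutations"
    "HOL-Computational_Algebra.Formal_Power_Series"
begin

definition avoids_321 :: "nat \<Rightarrow> (nat \<Rightarrow> nat) \<Rightarrow> bool" where
  "avoids_321 m p \<longleftrightarrow>
     \<not> (\<exists>a b c. 1 \<le> a \<and> a < b \<and> b < c \<and> c \<le> m \<and> p a > p b \<and> p b > p c)"

definition binary_shrub_forests_321 :: "nat \<Rightarrow> (nat \<Rightarrow> nat) set" where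
  "binary_shrub_forests_321 n =
     {p. p permutes {1..3 * n} \<and> avoids_321 (3 * n) p \<and>
         (\<forall>i<n. p (3 * i + 1) < p (3 * i + 2) \<and> p (3 * i + 1) < p (3 * i + 3))}"

definition H0 :: "real fps" where
  "H0 = Abs_fps (\<lambda>n. of_nat (card (binary_shrub_forests_321 n)))"

lemma H0_constant_term: "fps_nth H0 0 = 1"
proof -
  have "binary_shrub_forests_321 0 = {id}"
    by (auto simp: binary_shrub_forests_321_def avoids_321_def)
  then show ?thesis
    by (simp add: H0_def)
qed

end

theory Submission
  imports
    Defs
    "HOL-Computational_Algebra.Fundamental_Theorem_Algebra"
    "HOL-Computational_Algebra.Polynomial_FPS"
begin

text \<open>
  Reading a 321-avoiding permutation from left to right, every entry is either a new maximum or the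
  least value still missing. Let the height of a prefix be the number of values missing below its
  maximum. Appending a shrub then changes the height like one step of a lattice walk on the
  nonnegative integers, with kernel equation x(1 - y + y^3) = y^3 (1 - y)^3. Over the power series
  in x the kernel splits into two monic cubics (Hensel). Cancelling the cubic with the small roots
  shows that x H0 is the difference of the values q(1) - q(0) for the two cubics q. Eliminating
  their coefficients gives the polynomial; it is even because exchanging the cubics changes the
  sign of H0.

  The growth rate is the minimum r of (1 - y + y^3) / (y (1 - y))^3 on the unit interval. It is an
  upper bound, as one sees by weighting heights with y^height. If the growth were slower, then for
  some x > 1/r the generating functions by height would converge at x to a positive solution of the
  linear recurrence with characteristic polynomial x(1 - y + y^3) - y^3 (1 - y)^3. As this polynomial
  has no root y >= 0, it divides a polynomial with nonnegative coefficients, which is impossible.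
\<close>

unbundle fps_syntax

section \<open>Prefixes of 321-avoiding permutations\<close>

text \<open>Let y mark the height. Every step down loses a boundary term, so the functional equation
  involves \<open>F $ 0\<close>, \<open>F $ 1\<close> and \<open>F $ 2\<close> besides F itself:
  three unknowns, matched by the three kernel roots that vanish with x. These roots are Puiseux
  series in the cube root of x; splitting off the monic cubic that collects them keeps all
  computations in ordinary power series. The degree 20 in H0 is the number of ways to choose three
  of the six kernel roots; swapping the chosen three with the rest pairs the choices, which leaves
  degree 10 in the square of x H0. The two claims share only the kernel equation: reading the growth
  rate off the polynomial would require finding the branch that H0 follows and its dominant
  singularity. The number 1/r is the x at which two positive kernel roots merge; the quartic arises
  by eliminating the saddle point t from r (t (1 - t))^3 = 1 - t + t^3 and 3 t^4 - 5 t^2 + 8 t - 3 =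
  0.\<close>

definition max_entry :: "nat list \<Rightarrow> nat" where
  "max_entry w = Max (insert 0 (set w))"

definition least_missing :: "nat list \<Rightarrow> nat" where
  "least_missing w = (LEAST v. 1 \<le> v \<and> v \<notin> set w)"

text \<open>An entry below the current maximum that skips a smaller missing value would become the
  middle of a 321 once that value appears, so only the least missing value may be filled in. If
  nothing is missing below the maximum, the least missing value exceeds it and counts as a new
  maximum; the side condition of the last rule keeps the two cases disjoint. Values are unbounded,
  as a prefix does not know the length of the whole permutation.\<close>

inductive admissible :: "nat list \<Rightarrow> bool" where
  "admissible []"
| "admissible w \<Longrightarrow> max_entry w < v \<Longrightarrow> admissible (w @ [v])"
| "admissible w \<Longrightarrow> least_missing w < max_entry w \<Longrightarrow> admissible (w @ [least_missing w])"

lemma max_entry_ge: "v \<in> set w \<Longrightarrow> v \<le> max_entry w"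
  by (simp add: max_entry_def)

lemma max_entry_Nil [simp]: "max_entry [] = 0"
  by (simp add: max_entry_def)

lemma max_entry_snoc [simp]: "max_entry (w @ [v]) = max (max_entry w) v"
  by (simp add: max_entry_def insert_commute [of 0] max.commute)

lemma max_entry_in_set: "0 < max_entry w \<Longrightarrow> max_entry w \<in> set w"
  using Max_in [of "insert 0 (set w)"] by (auto simp: max_entry_def)

lemma least_missing_spec: "1 \<le> least_missing w \<and> least_missing w \<notin> set w"
  unfolding least_missing_def by (rule LeastI [of _ "Suc (max_entry w)"]) (use max_entry_ge in fastforce)

lemma least_missing_le: "1 \<le> v \<Longrightarrow> v \<notin> set w \<Longrightarrow> least_missing w \<le> v"
  unfolding least_missing_def by (rule Least_le) simp

lemma less_least_missing: "1 \<le> v \<Longrightarrow> v < least_missing w \<Longrightarrow> v \<in> set w"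
  using least_missing_le leD by blast

lemma admissible_snoc: "admissible (w @ [v]) \<longleftrightarrow> admissible w \<and> (max_entry w < v \<or> v =
    least_missing w \<and> v < max_entry w)"
  by (subst admissible.simps) auto

lemma admissible_prefix: "admissible (u @ v) \<Longrightarrow> admissible u"
  by (induction v rule: rev_induct) (auto simp: admissible_snoc simp flip: append_assoc)

lemma admissible_distinct: "admissible w \<Longrightarrow> distinct w \<and> 0 \<notin> set w"
proof (induction rule: admissible.induct)
  case (2 w v)
  then show ?case using max_entry_ge [of v w] by auto
next
  case (3 w)
  then show ?case using least_missing_spec [of w] by auto
qed simp

lemma admissible_subset: "admissible w \<Longrightarrow> set w \<subseteq> {1..max_entry w}"
  using admissible_distinct max_entry_ge by (fastforce simp: Suc_le_eq intro: gr0I)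

lemma admissible_length_le: "admissible w \<Longrightarrow> length w \<le> max_entry w"
  using card_mono [OF _ admissible_subset] admissible_distinct by (fastforce simp: distinct_card)

lemma admissible_full: "admissible w \<Longrightarrow> length w = max_entry w \<Longrightarrow> set w = {1..max_entry w}"
  by (intro card_subset_eq admissible_subset) (auto simp: distinct_card admissible_distinct)

text \<open>The entries are distinct and lie between 1 and the maximum, so a gap below the maximum
  exists exactly if the height, the maximum minus the length, is positive.\<close>

lemma least_missing_less_max_entry_iff: "admissible w \<Longrightarrow> least_missing w < max_entry w
    \<longleftrightarrow> length w < max_entry w"
proof
  assume w: "admissible w" and "least_missing w < max_entry w"
  then show "length w < max_entry w"
    using admissible_length_le [OF w] admissible_full [OF w] least_missing_spec [of w] by fastforce
next
  assume w: "admissible w" and less: "length w < max_entry w"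
  have "set w \<noteq> {1..max_entry w}"
    using less distinct_card [of w] admissible_distinct [OF w] by auto
  then obtain v where v: "v \<in> {1..max_entry w}" "v \<notin> set w"
    using admissible_subset [OF w] by blast
  then have "v \<noteq> max_entry w"
    using max_entry_in_set [of w] by auto
  with v show "least_missing w < max_entry w"
    using least_missing_le [of v w] by simp
qed

definition append_max :: "nat list set \<Rightarrow> nat list set" where
  "append_max W = {w @ [v] | w v. w \<in> W \<and> max_entry w < v}"

definition append_missing :: "nat list set \<Rightarrow> nat list set" where
  "append_missing W = {w @ [least_missing w] | w. w \<in> W \<and> least_missing w < max_entry w}"

text \<open>The new maximum that keeps height 0. It is the one way for a shrub to open with a
  maximum and still end by filling a gap: that gap then lies between its first two entries.\<close>

definition append_next :: "nat list set \<Rightarrow> nat list set" where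
  "append_next W = {w @ [Suc (max_entry w)] | w. w \<in> W \<and> length w = max_entry w}"

lemma snoc_in_append_max [simp]: "w @ [v] \<in> append_max W \<longleftrightarrow> w \<in> W \<and> max_entry w < v"
  and snoc_in_append_missing [simp]: "w @ [v] \<in> append_missing W \<longleftrightarrow> w \<in> W \<and> v =
      least_missing w \<and> least_missing w < max_entry w"
  and snoc_in_append_next [simp]: "w @ [v] \<in> append_next W \<longleftrightarrow> w \<in> W \<and> v = Suc
      (max_entry w) \<and> length w = max_entry w"
  by (auto simp: append_max_def append_missing_def append_next_def)

text \<open>The first entry of a shrub is the smallest one. This is automatic if it is the least missing value.
  If it is a new maximum, then so is the second entry, and the third entry can be a missing value only
  if nothing is missing below the first entry.\<close>

definition add_shrub :: "nat list set \<Rightarrow> nat list set" where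
  "add_shrub W = append_max (append_max (append_max W \<union> append_missing W) \<union> append_missing
      (append_missing W)) \<union> append_missing (append_max (append_next W \<union> append_missing W) \<union>
      append_missing (append_missing W))"

definition admissible_words :: "nat \<Rightarrow> nat list set \<Rightarrow> bool" where
  "admissible_words L W \<longleftrightarrow> (\<forall>w\<in>W. admissible w \<and> length w = L)"

lemma admissible_words_append_max: "admissible_words L W \<Longrightarrow> admissible_words (Suc L) (append_max W)"
  by (auto simp: admissible_words_def append_max_def admissible_snoc)

lemma admissible_words_append_missing: "admissible_words L W \<Longrightarrow> admissible_words (Suc L) (append_missing W)"
  by (auto simp: admissible_words_def append_missing_def admissible_snoc)

lemma admissible_words_append_next: "admissible_words L W \<Longrightarrow> admissible_words (Suc L) (append_next W)"
  by (auto simp: admissible_words_def append_next_def admissible_snoc)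

lemma admissible_words_Un: "admissible_words L V \<Longrightarrow> admissible_words L W \<Longrightarrow>
    admissible_words L (V \<union> W)"
  by (auto simp: admissible_words_def)

lemma admissible_words_add_shrub: "admissible_words L W \<Longrightarrow> admissible_words (L + 3) (add_shrub W)"
  by (simp add: add_shrub_def admissible_words_append_max admissible_words_append_missing
      admissible_words_append_next admissible_words_Un numeral_3_eq_3)

lemma add_shrub_iff:
  assumes "admissible w"
  shows "w @ [a, b, c] \<in> add_shrub W \<longleftrightarrow> w \<in> W \<and> admissible (w @ [a, b, c]) \<and> a
      < b \<and> a < c"
proof -
  have snoc: "w @ [a, b, c] = ((w @ [a]) @ [b]) @ [c]" by simp
  have append_missing_less: "a < v" if "a = least_missing w" "1 \<le> v" "v \<notin> set w" "v \<noteq> a" for v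
    using least_missing_le [of v w] that by simp
  have mex1: "a < least_missing (w @ [a])" if "a = least_missing w"
    using append_missing_less [OF that, of "least_missing (w @ [a])"] least_missing_spec [of "w @ [a]"] by auto
  have mex2: "a < least_missing ((w @ [a]) @ [b])" if "a = least_missing w"
    using append_missing_less [OF that, of "least_missing ((w @ [a]) @ [b])"] least_missing_spec [of "(w @ [a]) @
        [b]"] by auto
  \<comment> \<open>If all values below \<open>a\<close> are used up, they are in \<open>w\<close>,
    because \<open>b\<close> is larger than \<open>a\<close>. Then \<open>w\<close> has at least
    \<open>a - 1\<close> entries, while its length is at most its maximum, which is below
    \<open>a\<close>. So \<open>w\<close> has no gap and \<open>a\<close> is the next value.\<close>
  have low: "a < least_missing ((w @ [a]) @ [b]) \<longleftrightarrow> a = Suc (max_entry w) \<and> length w =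
      max_entry w" if "max_entry w < a" "a < b"
  proof
    assume "a = Suc (max_entry w) \<and> length w = max_entry w"
    then have "set w = {1..max_entry w}" "a = Suc (max_entry w)"
      using admissible_full [OF assms] by auto
    then show "a < least_missing ((w @ [a]) @ [b])"
      using least_missing_spec [of "(w @ [a]) @ [b]"] by (cases "least_missing ((w @ [a]) @ [b]) \<le> a") (auto
          simp: le_Suc_eq)
  next
    assume *: "a < least_missing ((w @ [a]) @ [b])"
    have "{1..<a} \<subseteq> set w"
    proof
      fix v assume "v \<in> {1..<a}"
      then show "v \<in> set w"
        using less_least_missing [of v "(w @ [a]) @ [b]"] * \<open>a < b\<close> by auto
    qed
    then have "card {1..<a} \<le> length w"
      using card_mono [of "set w" "{1..<a}"] card_length [of w] by (meson List.finite_set le_trans)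
    then show "a = Suc (max_entry w) \<and> length w = max_entry w"
      using admissible_length_le [OF assms] \<open>max_entry w < a\<close> by (simp; linarith)
  qed
  \<comment> \<open>U and D say that the entry in that position is a new maximum or the least
    missing value; Z1 says that the first entry is a new maximum with no gap below it. The facts
    below tie these to the two inequalities, which makes the claim propositional.\<close>
  define U1 D1 Z1 where "U1 \<longleftrightarrow> max_entry w < a" and "D1 \<longleftrightarrow> a = least_missing
      w \<and> least_missing w < max_entry w"
    and "Z1 \<longleftrightarrow> a = Suc (max_entry w) \<and> length w = max_entry w"
  define U2 D2 where "U2 \<longleftrightarrow> max_entry (w @ [a]) < b"
    and "D2 \<longleftrightarrow> b = least_missing (w @ [a]) \<and> least_missing (w @ [a]) < max_entry (w @ [a])"
  define U3 D3 where "U3 \<longleftrightarrow> max_entry ((w @ [a]) @ [b]) < c"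
    and "D3 \<longleftrightarrow> c = least_missing ((w @ [a]) @ [b]) \<and> least_missing ((w @ [a]) @ [b]) <
        max_entry ((w @ [a]) @ [b])"
  note defs = U1_def D1_def Z1_def U2_def D2_def U3_def D3_def
  have "w @ [a, b, c] \<in> add_shrub W \<longleftrightarrow>
      w \<in> W \<and> (U3 \<and> (U2 \<and> (U1 \<or> D1) \<or> D2 \<and> D1) \<or> D3 \<and> (U2 \<and> (Z1 \<or>
          D1) \<or> D2 \<and> D1))"
    unfolding snoc add_shrub_def Un_iff snoc_in_append_max snoc_in_append_missing snoc_in_append_next defs by blast
  moreover have "admissible (w @ [a, b, c]) \<longleftrightarrow> (U1 \<or> D1) \<and> (U2 \<or> D2) \<and> (U3 \<or> D3)"
    unfolding snoc admissible_snoc defs using assms by blast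
  moreover have "D1 \<Longrightarrow> U2 \<or> D2 \<Longrightarrow> a < b"
    unfolding defs using mex1 by auto
  moreover have "D1 \<Longrightarrow> U3 \<or> D3 \<Longrightarrow> a < c"
    unfolding defs max_entry_snoc using mex2 by auto
  moreover have "U2 \<Longrightarrow> a < b" "D2 \<Longrightarrow> U1 \<Longrightarrow> \<not> a < b" "U3
      \<Longrightarrow> a < c" "Z1 \<Longrightarrow> U1"
    unfolding defs max_entry_snoc by auto
  moreover have "U1 \<Longrightarrow> U2 \<Longrightarrow> D3 \<Longrightarrow> a < c \<longleftrightarrow> Z1"
    unfolding defs using low by auto
  ultimately show ?thesis by blast
qed

section \<open>Generating functions by height\<close>

definition height_gf :: "nat list set \<Rightarrow> real fps" where
  "height_gf W = Abs_fps (\<lambda>k. real (card {w \<in> W. max_entry w = length w + k}))"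

text \<open>New maxima are unbounded, so the words of a given length can be infinite in number;
  fixing the height as well bounds the entries. This makes the coefficients of
  \<open>height_gf\<close> meaningful, since \<open>card\<close> is 0 on infinite sets.\<close>

lemma finite_words: "admissible_words L W \<Longrightarrow> finite {w \<in> W. max_entry w = length w + k}"
proof (rule finite_subset)
  show "finite {w. set w \<subseteq> {1..L + k} \<and> length w = L}"
    by (rule finite_lists_length_eq) simp
  show "{w \<in> W. max_entry w = length w + k} \<subseteq> {w. set w \<subseteq> {1..L + k} \<and> length w = L}"
      if "admissible_words L W"
    using that admissible_subset unfolding admissible_words_def by fastforce
qed

lemma height_gf_Un: "admissible_words L V \<Longrightarrow> admissible_words L W \<Longrightarrow> V \<inter> W =
    {} \<Longrightarrow> height_gf (V \<union> W) = height_gf V + height_gf W"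
proof (rule fps_ext)
  fix k assume "admissible_words L V" "admissible_words L W" "V \<inter> W = {}"
  then have "card ({w \<in> V. max_entry w = length w + k} \<union> {w \<in> W. max_entry w = length w + k}) =
      card {w \<in> V. max_entry w = length w + k} + card {w \<in> W. max_entry w = length w + k}"
    by (intro card_Un_disjoint finite_words) auto
  moreover have "{w \<in> V \<union> W. max_entry w = length w + k} = {w \<in> V. max_entry w = length w + k}
      \<union> {w \<in> W. max_entry w = length w + k}"
    by auto
  ultimately show "height_gf (V \<union> W) $ k = (height_gf V + height_gf W) $ k"
    by (simp add: height_gf_def)
qed

text \<open>A word of height i \<le> k reaches height k by exactly one new maximum, the value
  \<open>Suc (length w) + k\<close>, and a word of larger height by none. Summing over i is
  multiplication by 1/(1 - X).\<close>

lemma height_gf_append_max: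
  assumes "admissible_words L W"
  shows "height_gf (append_max W) = Abs_fps (\<lambda>_. 1) * height_gf W"
proof (rule fps_ext)
  fix k
  have "{w \<in> append_max W. max_entry w = length w + k} =
      (\<Union>i\<in>{0..k}. (\<lambda>w. w @ [Suc (length w) + k]) ` {w \<in> W. max_entry w = length w + i})"
  proof (intro equalityI subsetI)
    fix u assume "u \<in> {w \<in> append_max W. max_entry w = length w + k}"
    then obtain w v where u: "u = w @ [v]" "w \<in> W" "max_entry w < v" and "max_entry u = length u + k"
      by (auto simp: append_max_def)
    then have v: "v = Suc (length w) + k" by simp
    have "length w \<le> max_entry w"
      using assms \<open>w \<in> W\<close> admissible_length_le by (auto simp: admissible_words_def)
    then have "max_entry w = length w + (max_entry w - length w)" "max_entry w - length w \<le> k"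
      using u v by auto
    then show "u \<in> (\<Union>i\<in>{0..k}. (\<lambda>w. w @ [Suc (length w) + k]) ` {w \<in> W. max_entry w =
        length w + i})"
      using u v by (auto intro!: bexI [of _ "max_entry w - length w"])
  qed auto
  moreover have "card \<dots> = (\<Sum>i\<in>{0..k}. card {w \<in> W. max_entry w = length w + i})"
    by (subst card_UN_disjoint) (auto simp: card_image inj_on_def finite_words [OF assms])
  ultimately show "height_gf (append_max W) $ k = (Abs_fps (\<lambda>_. 1) * height_gf W) $ k"
    by (subst mult.commute) (simp add: height_gf_def fps_mult_nth)
qed

text \<open>Filling a gap is possible in one way from every positive height and lowers it by one;
  words of height 0 drop out, as does the constant term under the shift.\<close>

lemma height_gf_append_missing:
  assumes "admissible_words L W"
  shows "height_gf (append_missing W) = fps_shift 1 (height_gf W)"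
proof (rule fps_ext)
  fix k
  have "append_missing W = (\<lambda>w. w @ [least_missing w]) ` {w \<in> W. length w < max_entry w}"
    using least_missing_less_max_entry_iff assms by (auto simp: append_missing_def admissible_words_def)
  moreover have "max_entry (w @ [least_missing w]) = max_entry w" if "w \<in> W" "length w < max_entry w" for w
    using least_missing_less_max_entry_iff [of w] that assms by (simp add: admissible_words_def)
  ultimately have "{w \<in> append_missing W. max_entry w = length w + k} = (\<lambda>w. w @ [least_missing w]) `
      {w \<in> W. max_entry w = length w + Suc k}"
    by (auto simp del: max_entry_snoc)
  then show "height_gf (append_missing W) $ k = fps_shift 1 (height_gf W) $ k"
    by (simp add: height_gf_def card_image inj_on_def)
qed

lemma height_gf_append_next: "height_gf (append_next W) = fps_const (height_gf W $ 0)"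
proof (rule fps_ext)
  fix k
  have "{w \<in> append_next W. max_entry w = length w + k} =
      (if k = 0 then (\<lambda>w. w @ [Suc (max_entry w)]) ` {w \<in> W. max_entry w = length w} else {})"
    by (auto simp: append_next_def)
  then show "height_gf (append_next W) $ k = fps_const (height_gf W $ 0) $ k"
    by (simp add: height_gf_def card_image inj_on_def)
qed

lemma append_max_Int_append_missing: "append_max V \<inter> append_missing W = {}"
  by (auto simp: append_max_def append_missing_def)

lemma append_next_Int_append_missing: "append_next V \<inter> append_missing W = {}"
  by (auto simp: append_next_def append_missing_def)

text \<open>\<open>add_shrub\<close> read on generating functions: \<open>u\<close> for a new
  maximum, \<open>D\<close> for filling a gap, the constant term for \<open>append_next\<close>. The
  operator is linear and, over the reals, preserves nonnegative coefficients; the growth estimates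
  rest on this.\<close>

definition shrub_step :: "'a fps \<Rightarrow> 'a::comm_ring_1 fps" where
  "shrub_step f = (let u = Abs_fps (\<lambda>_. 1); D = fps_shift 1 in
     u * (u * (u * f + D f) + D (D f)) + D (u * (fps_const (f $ 0) + D f) + D (D f)))"

lemma height_gf_add_shrub:
  assumes "admissible_words L W"
  shows "height_gf (add_shrub W) = shrub_step (height_gf W)"
proof -
  note w = admissible_words_append_max admissible_words_append_missing admissible_words_append_next admissible_words_Un assms
  have 1: "height_gf (append_max W \<union> append_missing W) = Abs_fps (\<lambda>_. 1) * height_gf W + fps_shift 1
      (height_gf W)"
    by (simp add: height_gf_Un [of "Suc L"] height_gf_append_max [OF assms] height_gf_append_missing [OF assms] w
        append_max_Int_append_missing)
  have 2: "height_gf (append_missing (append_missing W)) = fps_shift 1 (fps_shift 1 (height_gf W))"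
    by (simp only: height_gf_append_missing [OF admissible_words_append_missing [OF assms]]
        height_gf_append_missing [OF assms])
  have 3: "height_gf (append_next W \<union> append_missing W) = fps_const (height_gf W $ 0) + fps_shift 1 (height_gf W)"
    by (simp add: height_gf_Un [of "Suc L"] height_gf_append_next height_gf_append_missing [OF assms] w
        append_next_Int_append_missing)
  have 4: "height_gf (append_max V \<union> append_missing (append_missing W)) = Abs_fps (\<lambda>_. 1) *
      height_gf V + height_gf (append_missing (append_missing W))" if "admissible_words (Suc L) V" for V
    by (simp add: height_gf_Un [of "Suc (Suc L)"] height_gf_append_max [OF that] w that append_max_Int_append_missing)
  have 5: "height_gf (append_max V \<union> append_missing V') = Abs_fps (\<lambda>_. 1) * height_gf V + fps_shift
      1 (height_gf V')"
    if "admissible_words (Suc (Suc L)) V" "admissible_words (Suc (Suc L)) V'" for V V'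
    by (simp add: height_gf_Un [of "Suc (Suc (Suc L))"] height_gf_append_max [OF that(1)] height_gf_append_missing
        [OF that(2)] admissible_words_append_max admissible_words_append_missing that
        append_max_Int_append_missing)
  show ?thesis
    unfolding add_shrub_def shrub_step_def Let_def
    by (simp add: 5 4 w, simp add: 1 2 3)
qed

section \<open>Forests as words of height zero\<close>

primrec shrub_words :: "nat \<Rightarrow> nat list set" where
  "shrub_words 0 = {[]}"
| "shrub_words (Suc n) = add_shrub (shrub_words n)"

lemma admissible_words_shrub_words: "admissible_words (3 * n) (shrub_words n)"
proof (induction n)
  case 0
  then show ?case by (simp add: admissible_words_def admissible.intros)
next
  case (Suc n)
  then show ?case using admissible_words_add_shrub [of "3 * n"] by (simp add: add.commute)
qed

lemma shrub_words_iff: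
  "w \<in> shrub_words n \<longleftrightarrow> admissible w \<and> length w = 3 * n \<and>
     (\<forall>i<n. w ! (3 * i) < w ! (3 * i + 1) \<and> w ! (3 * i) < w ! (3 * i + 2))"
proof (induction n arbitrary: w)
  case 0
  then show ?case by (auto simp: admissible.intros)
next
  case (Suc n)
  show ?case
  proof (cases "admissible w \<and> length w = 3 * Suc n")
    case False
    then show ?thesis using admissible_words_shrub_words [of "Suc n"] by (auto simp: admissible_words_def)
  next
    case True
    define u a b c where "u = take (3 * n) w" and "a = w ! (3 * n)" and "b = w ! (3 * n + 1)" and "c = w ! (3 * n + 2)"
    have lu: "length u = 3 * n" using True by (simp add: u_def)
    have w: "w = u @ [a, b, c]"
    proof (rule nth_equalityI)
      show "length w = length (u @ [a, b, c])" using True lu by simp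
      fix i assume "i < length w"
      then have "i < 3 * n \<or> i = 3 * n \<or> i = 3 * n + 1 \<or> i = 3 * n + 2" using True by auto
      then show "w ! i = (u @ [a, b, c]) ! i"
        by (auto simp: nth_append lu) (auto simp: u_def a_def b_def c_def)
    qed
    have "admissible u" using True w admissible_prefix by blast
    have "w ! (3 * i) = u ! (3 * i) \<and> w ! (3 * i + 1) = u ! (3 * i + 1) \<and> w ! (3 * i + 2) = u ! (3 * i +
        2)" if "i < n" for i
      using that lu unfolding w by (auto simp: nth_append)
    then have "(\<forall>i<Suc n. w ! (3 * i) < w ! (3 * i + 1) \<and> w ! (3 * i) < w ! (3 * i + 2)) \<longleftrightarrow>
        (\<forall>i<n. u ! (3 * i) < u ! (3 * i + 1) \<and> u ! (3 * i) < u ! (3 * i + 2)) \<and> a < b \<and> a < c"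
      by (auto simp: less_Suc_eq a_def b_def c_def)
    moreover have "w \<in> shrub_words (Suc n) \<longleftrightarrow> u \<in> shrub_words n \<and> admissible w
        \<and> a < b \<and> a < c"
      unfolding w shrub_words.simps by (rule add_shrub_iff [OF \<open>admissible u\<close>])
    ultimately show ?thesis
      using Suc.IH [of u] True lu \<open>admissible u\<close> by auto
  qed
qed

text \<open>The middle entry of a 321 is not a new maximum, so in an admissible word it is the least
  missing value, and no smaller value is left for the third entry. Conversely, if an entry is
  neither of the two, then the maximum before it, the entry itself and the least missing value,
  which has to occur later, form a 321.\<close>

lemma admissible_permutation_iff:
  assumes p: "p permutes {1..m}"
  shows "admissible (map p [1..<Suc m]) \<longleftrightarrow> avoids_321 m p"
proof
  assume admissible: "admissible (map p [1..<Suc m])"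
  show "avoids_321 m p"
    unfolding avoids_321_def
  proof safe
    fix a b c assume abc: "1 \<le> a" "a < b" "b < c" "c \<le> m" "p b < p a" "p c < p b"
    define u where "u = map p [1..<b]"
    have "[1..<Suc m] = [1..<b] @ b # [Suc b..<Suc m]"
      using abc upt_add_eq_append [of 1 b "Suc m - b"] by (simp add: upt_conv_Cons)
    then have "map p [1..<Suc m] = (u @ [p b]) @ map p [Suc b..<Suc m]"
      by (simp add: u_def)
    with admissible have "admissible (u @ [p b])" by (metis admissible_prefix)
    moreover have "p a \<in> set u" using abc by (simp add: u_def)
    ultimately have "p b = least_missing u"
      using max_entry_ge [of "p a" u] abc by (auto simp: admissible_snoc)
    moreover have "p c \<notin> set u"
      using abc permutes_inj [OF p] by (auto simp: u_def inj_eq)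
    moreover have "p c \<in> {1..m}" using permutes_in_image [OF p, of c] abc by simp
    ultimately show False using least_missing_le [of "p c" u] abc by auto
  qed
next
  assume av: "avoids_321 m p"
  have "admissible (map p [1..<Suc j])" if "j \<le> m" for j
    using that
  proof (induction j)
    case 0
    then show ?case by (simp add: admissible.intros)
  next
    case (Suc j)
    define u where "u = map p [1..<Suc j]"
    have admissible: "admissible u" using Suc by (simp add: u_def)
    have img: "p c \<in> {1..m}" if "c \<in> {1..m}" for c using permutes_in_image [OF p] that by simp
    have nin: "p (Suc j) \<notin> set u"
      using permutes_inj [OF p] by (auto simp: u_def inj_eq)
    have pos: "1 \<le> p (Suc j)" using img [of "Suc j"] Suc.prems by simp
    have "max_entry u < p (Suc j) \<or> p (Suc j) = least_missing u \<and> least_missing u < max_entry u"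
    proof (rule disjCI)
      assume "\<not> (p (Suc j) = least_missing u \<and> least_missing u < max_entry u)"
      moreover have "least_missing u \<le> p (Suc j)" using least_missing_le pos nin by blast
      ultimately have less: "least_missing u < p (Suc j) \<or> max_entry u \<le> p (Suc j)" by linarith
      show "max_entry u < p (Suc j)"
      proof (rule ccontr)
        assume "\<not> max_entry u < p (Suc j)"
        then have le: "p (Suc j) \<le> max_entry u" by simp
        then have mxin: "max_entry u \<in> set u" using max_entry_in_set pos by simp
        with le nin have lt: "p (Suc j) < max_entry u" by (metis le_neq_implies_less)
        with less have e: "least_missing u < p (Suc j)" by simp
        obtain a where a: "1 \<le> a" "a \<le> j" "max_entry u = p a" using mxin by (auto simp: u_def)
        have "least_missing u \<in> {1..m}" using least_missing_spec [of u] e img [of "Suc j"] Suc.prems by simp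
        then obtain c where c: "c \<in> {1..m}" "least_missing u = p c"
          using permutes_image [OF p] by (metis imageE)
        have "c \<noteq> Suc j" using c e by auto
        moreover have "\<not> c \<le> j" using least_missing_spec [of u] c by (auto simp: u_def)
        ultimately have "Suc j < c" by simp
        with a c e lt av show False
          unfolding avoids_321_def by (metis atLeastAtMost_iff le_imp_less_Suc)
      qed
    qed
    then have "admissible (u @ [p (Suc j)])" using admissible by (auto simp: admissible_snoc)
    then show ?case by (simp add: u_def)
  qed
  then show "admissible (map p [1..<Suc m])" by simp
qed

lemma card_binary_shrub_forests_321:
  "real (card (binary_shrub_forests_321 n)) = height_gf (shrub_words n) $ 0"
proof -
  define \<phi> :: "(nat \<Rightarrow> nat) \<Rightarrow> nat list" where "\<phi> p = map p [1..<Suc (3 * n)]" for p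
  have nth: "\<phi> p ! i = p (i + 1)" if "i < 3 * n" for p i
    using that by (simp add: \<phi>_def nth_append del: upt_Suc)
  have shrub: "(\<forall>i<n. \<phi> p ! (3 * i) < \<phi> p ! (3 * i + 1) \<and> \<phi> p ! (3 * i) < \<phi> p ! (3
      * i + 2)) \<longleftrightarrow>
      (\<forall>i<n. p (3 * i + 1) < p (3 * i + 2) \<and> p (3 * i + 1) < p (3 * i + 3))" for p
    by (simp add: nth numeral_3_eq_3)
  have "inj_on \<phi> (binary_shrub_forests_321 n)"
  proof (rule inj_onI)
    fix p q assume pq: "p \<in> binary_shrub_forests_321 n" "q \<in> binary_shrub_forests_321 n" "\<phi> p = \<phi> q"
    show "p = q"
    proof
      fix x
      show "p x = q x"
      proof (cases "x \<in> {1..3 * n}")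
        case True
        then have "x - 1 < 3 * n" "x - 1 + 1 = x" by auto
        then show ?thesis using nth [of "x - 1" p] nth [of "x - 1" q] pq(3) by simp
      next
        case False
        then show ?thesis
          using pq permutes_not_in by (metis (mono_tags, lifting) binary_shrub_forests_321_def mem_Collect_eq)
      qed
    qed
  qed
  moreover have "\<phi> ` binary_shrub_forests_321 n = {w \<in> shrub_words n. max_entry w = length w}"
  proof (intro equalityI subsetI)
    fix w assume "w \<in> \<phi> ` binary_shrub_forests_321 n"
    then obtain p where p: "p permutes {1..3 * n}" "avoids_321 (3 * n) p" "w = \<phi> p"
      and s: "\<forall>i<n. p (3 * i + 1) < p (3 * i + 2) \<and> p (3 * i + 1) < p (3 * i + 3)"
      by (auto simp: binary_shrub_forests_321_def)
    have admissible: "admissible w" using p admissible_permutation_iff [of p "3 * n"] by (simp add: \<phi>_def)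
    have "length w = 3 * n" by (simp add: p \<phi>_def)
    have "set w = p ` {1..3 * n}" by (auto simp: p \<phi>_def)
    then have set: "set w = {1..3 * n}" using permutes_image [OF p(1)] by simp
    have "max_entry w \<le> 3 * n" using max_entry_in_set [of w] set by (cases "max_entry w = 0") auto
    then have "max_entry w = length w" using admissible_length_le [OF admissible] \<open>length w = 3 * n\<close> by simp
    then show "w \<in> {w \<in> shrub_words n. max_entry w = length w}"
      using admissible s \<open>length w = 3 * n\<close> shrub [of p] p by (simp add: shrub_words_iff)
  next
    fix w assume "w \<in> {w \<in> shrub_words n. max_entry w = length w}"
    then have w: "w \<in> shrub_words n" "max_entry w = length w" by auto
    then have admissible: "admissible w" and len: "length w = 3 * n" by (simp_all add: shrub_words_iff)
    have set: "set w = {1..3 * n}" using admissible_full [OF admissible] w len by simp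
    \<comment> \<open>The inverse map: \<open>permutes\<close> demands the identity outside
      \<open>{1..3 * n}\<close>, and list positions start at 0.\<close>
    define p where "p x = (if x \<in> {1..3 * n} then w ! (x - 1) else x)" for x
    have "bij_betw ((!) w) {..<length w} (set w)"
      using admissible_distinct [OF admissible] by (intro bij_betw_nth) auto
    moreover have "bij_betw (\<lambda>x. x - 1) {1..3 * n} {..<length w}"
      by (rule bij_betw_byWitness [where f' = Suc]) (auto simp: len)
    ultimately have "bij_betw ((!) w \<circ> (\<lambda>x. x - 1)) {1..3 * n} {1..3 * n}"
      using bij_betw_trans set by metis
    then have "bij_betw p {1..3 * n} {1..3 * n}"
      by (subst bij_betw_cong [where g = "(!) w \<circ> (\<lambda>x. x - 1)"]) (auto simp: p_def)
    then have perm: "p permutes {1..3 * n}"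
      by (rule bij_imp_permutes) (simp only: p_def if_False)
    have \<phi>: "\<phi> p = w"
    proof (rule nth_equalityI)
      show "length (\<phi> p) = length w" by (simp add: \<phi>_def len)
      show "\<phi> p ! i = w ! i" if "i < length (\<phi> p)" for i
        using that nth [of i p] by (simp add: \<phi>_def p_def del: upt_Suc)
    qed
    have "admissible (\<phi> p)" using admissible by (simp only: \<phi>)
    then have "avoids_321 (3 * n) p"
      using admissible_permutation_iff [OF perm] unfolding \<phi>_def by blast
    then have "p \<in> binary_shrub_forests_321 n"
      using perm shrub [of p] w(1) by (simp add: binary_shrub_forests_321_def \<phi> shrub_words_iff)
    then show "w \<in> \<phi> ` binary_shrub_forests_321 n" using \<phi> by blast
  qed
  ultimately have "card (binary_shrub_forests_321 n) = card {w \<in> shrub_words n. max_entry w = length w}"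
    by (metis card_image)
  then show ?thesis by (simp add: height_gf_def)
qed

lemma height_gf_shrub_words: "height_gf (shrub_words n) = (shrub_step ^^ n) 1"
proof (induction n)
  case 0
  have "{w \<in> {[]}. max_entry w = length w + k} = (if k = 0 then {[]} else {})" for k
    by auto
  then show ?case by (auto simp: height_gf_def fps_eq_iff)
next
  case (Suc n)
  then show ?case by (simp add: height_gf_add_shrub [OF admissible_words_shrub_words])
qed

section \<open>The kernel equation\<close>

lemma fps_X_shift_1: "fps_X * fps_shift 1 f = f - fps_const (f $ 0)"
  for f :: "'a::comm_ring_1 fps"
  by (rule fps_ext) (auto simp: fps_X_mult_nth)

text \<open>Multiplication by X^3 (1 - X)^3 clears \<open>u\<close> = 1/(1 - X) and up to three
  nested shifts. Since \<open>X * D f\<close> is f without its constant term, each shift loses a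
  coefficient, and \<open>F $ 0\<close>, \<open>F $ 1\<close>, \<open>F $ 2\<close> stay on the
  right as unknowns. The factor \<open>c\<close> is later the variable x that counts shrubs, while X
  marks heights.\<close>

lemma kernel_identity:
  fixes F :: "'a :: idom fps" and c u :: "'a fps"
  defines "D \<equiv> fps_shift 1"
  assumes u: "u * (1 - fps_X) = 1"
    and F: "F = 1 + c * (u * (u * (u * F + D F) + D (D F)) + D (u * (fps_const (F $ 0) + D F) + D (D F)))"
  shows "(fps_X ^ 3 * (fps_X - 1) ^ 3 + c * (1 - fps_X + fps_X ^ 3)) * F =
    (fps_X - 1) * (fps_X ^ 3 * (1 - fps_X)^2 - c * (fps_const (F $ 0) * (1 - fps_X ^ 3 * (1 - fps_X))
      + fps_const (F $ 1) * (fps_X * (1 - fps_X) * (1 + fps_X - fps_X^2))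
      + fps_const (F $ 2) * (fps_X^2 * (1 - fps_X)^2)))"
proof -
  define X :: "'a fps" where "X = fps_X"
  define k0 k1 k2 where "k0 = fps_const (F $ 0)" and "k1 = fps_const (F $ 1)" and "k2 = fps_const (F $ 2)"
  define V where "V = u * (k0 + D F)"
  have u0: "u $ 0 = 1"
    using arg_cong [OF u, of "\<lambda>f. f $ 0"] by simp
  have D1: "X * D F = F - k0" and D2: "X * D (D F) = D F - k1" and D3: "X * D (D (D F)) = D (D F) - k2"
    unfolding X_def D_def fps_X_shift_1 k0_def k1_def k2_def by (simp_all add: numeral_2_eq_2)
  have "V $ 0 = F $ 0 + F $ 1"
    by (simp add: V_def u0 k0_def D_def)
  then have DV: "X * D V = V - (k0 + k1)"
    unfolding X_def D_def fps_X_shift_1 k0_def k1_def by (simp only: fps_const_add)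
  have D_add: "D (V + D (D F)) = D V + D (D (D F))"
    unfolding D_def by (rule fps_ext) simp
  have F': "F = 1 + c * (u * (u * (u * F + D F) + D (D F)) + D V + D (D (D F)))"
    using F unfolding k0_def [symmetric] V_def [symmetric] D_add by (simp add: add.assoc)
  have uX: "(1 - X) * u = 1"
    using u by (simp add: X_def mult.commute)
  \<comment> \<open>From here on the shifted series are atoms tied together only by ring relations,
    so that \<open>algebra\<close> applies.\<close>
  define W where "W = D V"
  define F1 where "F1 = D F"
  define F2 where "F2 = D (D F)"
  define F3 where "F3 = D (D (D F))"
  note [symmetric] = W_def F1_def F2_def F3_def
  have D1: "X * F1 = F - k0" and D2: "X * F2 = F1 - k1" and D3: "X * F3 = F2 - k2"
    and DV: "X * W = u * (k0 + F1) - (k0 + k1)"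
    using D1 D2 D3 DV unfolding F1_def F2_def F3_def W_def V_def by simp_all
  have F': "F = 1 + c * (u * (u * (u * F + F1) + F2) + W + F3)"
    using F' unfolding F1_def F2_def F3_def W_def .
  have p1: "(1 - X)^3 * (u * (u * (u * F + F1) + F2)) = F + (1 - X) * F1 + (1 - X)^2 * F2"
  proof -
    have "(1 - X)^3 * (u * (u * (u * F + F1) + F2)) =
      ((1-X)*u)^3 * F + (1-X) * ((1-X)*u)^2 * F1 + (1 - X)^2 * ((1-X)*u) * F2" by algebra
    then show ?thesis by (simp add: uX)
  qed
  have p2: "X * (1 - X) * W = k0 + F1 - (1 - X) * (k0 + k1)"
  proof -
    have "X * (1 - X) * W = (1 - X) * (X * W)" by algebra
    also have "\<dots> = ((1-X)*u) * (k0 + F1) - (1 - X) * (k0 + k1)" unfolding DV by algebra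
    finally show ?thesis by (simp add: uX)
  qed
  have "X^3 * F1 = X^2 * (X * F1)" by algebra
  then have X1: "X^3 * F1 = X^2 * (F - k0)" unfolding D1 .
  have X2: "X^3 * F2 = X * (F - k0) - X^2 * k1"
  proof -
    have "X^3 * F2 = X^2 * (X * F2)" by algebra
    also have "\<dots> = X * (X * F1) - X^2 * k1" unfolding D2 by algebra
    finally show ?thesis unfolding D1 .
  qed
  have X3: "X^3 * F3 = F - k0 - X * k1 - X^2 * k2"
  proof -
    have "X^3 * F3 = X^2 * (X * F3)" by algebra
    also have "\<dots> = X * (X * F2) - X^2 * k2" unfolding D3 by algebra
    also have "\<dots> = X * F1 - X * k1 - X^2 * k2" unfolding D2 by algebra
    finally show ?thesis unfolding D1 .
  qed
  have XW: "X^3 * ((1 - X) * W) = X^2 * k0 + X * (F - k0) - X^2 * (1 - X) * (k0 + k1)"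
  proof -
    have "X^3 * ((1 - X) * W) = X^2 * (X * (1 - X) * W)" by algebra
    also have "\<dots> = X^2 * k0 + X * (X * F1) - X^2 * (1 - X) * (k0 + k1)" unfolding p2 by algebra
    finally show ?thesis unfolding D1 .
  qed
  have "X^3 * (1 - X)^3 * F = X^3 * (1 - X)^3 + c * (X^3 * ((1 - X)^3 * (u * (u * (u * F + F1) + F2)))
      + (1 - X)^2 * (X^3 * ((1 - X) * W)) + (1 - X)^3 * (X^3 * F3))"
    by (subst F') algebra
  also have "\<dots> = X^3 * (1 - X)^3 + c * (X^3 * F + (1 - X) * (X^3 * F1) + (1 - X)^2 * (X^3 * F2)
      + (1 - X)^2 * (X^3 * ((1 - X) * W)) + (1 - X)^3 * (X^3 * F3))"
    unfolding p1 by algebra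
  finally have E: "X^3 * (1 - X)^3 * F = X^3 * (1 - X)^3 + c * (X^3 * F + (1 - X) * (X^3 * F1)
      + (1 - X)^2 * (X^3 * F2) + (1 - X)^2 * (X^3 * ((1 - X) * W)) + (1 - X)^3 * (X^3 * F3))" .
  have "(X^3 * (X - 1)^3 + c * (1 - X + X^3)) * F = c * (1 - X + X^3) * F - X^3 * (1 - X)^3 * F"
    by algebra
  also have "\<dots> = (X - 1) * (X^3 * (1 - X)^2 - c * (k0 * (1 - X^3 * (1 - X))
      + k1 * (X * (1 - X) * (1 + X - X^2)) + k2 * (X^2 * (1 - X)^2)))"
    unfolding E X1 X2 X3 XW by algebra
  finally show ?thesis
    unfolding k0_def k1_def k2_def X_def .
qed

section \<open>Fixed points in the X-adic metric and the splitting of the kernel\<close>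

definition fps_agree :: "nat \<Rightarrow> 'a fps \<Rightarrow> 'a::zero fps \<Rightarrow> bool" where
  "fps_agree n f g \<longleftrightarrow> (\<forall>j<n. f $ j = g $ j)"

lemma fps_agree_refl [simp]: "fps_agree n f f"
  by (simp add: fps_agree_def)

lemma fps_agree_add: "fps_agree n f g \<Longrightarrow> fps_agree n f' g' \<Longrightarrow> fps_agree n (f + f') (g + g')"
  for f :: "'a::comm_ring_1 fps"
  by (simp add: fps_agree_def)

lemma fps_agree_diff: "fps_agree n f g \<Longrightarrow> fps_agree n f' g' \<Longrightarrow> fps_agree n (f - f') (g - g')"
  for f :: "'a::comm_ring_1 fps"
  by (simp add: fps_agree_def)

lemma fps_agree_uminus: "fps_agree n f g \<Longrightarrow> fps_agree n (- f) (- g)"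
  for f :: "'a::comm_ring_1 fps"
  by (simp add: fps_agree_def)

lemma fps_agree_mult: "fps_agree n f g \<Longrightarrow> fps_agree n f' g' \<Longrightarrow> fps_agree n (f * f') (g * g')"
  for f :: "'a::comm_ring_1 fps"
  by (auto simp: fps_agree_def fps_mult_nth intro!: sum.cong)

lemma fps_agree_X_mult: "fps_agree n f g \<Longrightarrow> fps_agree (Suc n) (fps_X * f) (fps_X * g)"
  for f :: "'a::comm_ring_1 fps"
  by (auto simp: fps_agree_def fps_X_mult_nth)

text \<open>The X-adic contraction principle: the iterates from 0 agree to ever higher order, so
  their coefficients stabilize, and the limit takes coefficient j from iterate \<open>Suc j\<close>.
  The index \<open>i\<close> admits systems of equations.\<close>

lemma fps_contraction_fixpoint:
  fixes \<Phi> :: "('i \<Rightarrow> 'a::zero fps) \<Rightarrow> 'i \<Rightarrow> 'a fps"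
  assumes contr: "\<And>u v n i. (\<And>i. fps_agree n (u i) (v i)) \<Longrightarrow> fps_agree (Suc n) (\<Phi> u
      i) (\<Phi> v i)"
  shows "\<exists>v. \<Phi> v = v"
proof -
  define V where "V m = (\<Phi> ^^ m) (\<lambda>_. 0)" for m
  have step: "fps_agree m (V (Suc m) i) (V m i)" for m i
  proof (induction m arbitrary: i)
    case (Suc m)
    then show ?case using contr [of m "V (Suc m)" "V m"] by (simp add: V_def)
  qed (simp add: fps_agree_def)
  have stable: "V (m + d) i $ j = V m i $ j" if "j < m" for m d i j
  proof (induction d)
    case (Suc d)
    then show ?case using step [of "m + d" i] that by (simp add: fps_agree_def)
  qed simp
  define v where "v i = Abs_fps (\<lambda>j. V (Suc j) i $ j)" for i
  have agree: "fps_agree m (v i) (V m i)" for m i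
    unfolding fps_agree_def
  proof (intro allI impI)
    fix j assume "j < m"
    then show "v i $ j = V m i $ j"
      using stable [of j "Suc j" "m - Suc j" i] by (simp add: v_def)
  qed
  have "\<Phi> v i $ j = v i $ j" for i j
  proof -
    have "\<Phi> v i $ j = \<Phi> (V (Suc j)) i $ j"
      using contr [of "Suc j" v "V (Suc j)" i, OF agree] by (simp add: fps_agree_def)
    also have "\<dots> = V (Suc (Suc j)) i $ j" by (simp add: V_def)
    also have "\<dots> = v i $ j" using step [of "Suc j" i] by (simp add: v_def fps_agree_def)
    finally show ?thesis .
  qed
  then show ?thesis by (intro exI [of _ v] ext fps_ext)
qed

text \<open>The factorization of y^3 (y - 1)^3 + x (1 - y + y^3) into y^3 + a2 y^2 + a1 y + a0, which is y^3
  modulo x, and y^3 + b2 y^2 + b1 y + b0, with coefficients compared.\<close>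

lemma kernel_factorization:
  obtains a0 a1 a2 b0 b1 b2 :: "'a :: idom fps"
  where "a0 * b0 = fps_X" "a0 * b1 + a1 * b0 = - fps_X" "a0 * b2 + a1 * b1 + a2 * b0 = 0"
    "a0 + b0 + a1 * b2 + a2 * b1 = fps_X - 1" "a1 + b1 + a2 * b2 = 3" "a2 + b2 = - 3"
    "a0 $ 0 = 0" "a1 $ 0 = 0" "a2 $ 0 = 0"
proof -
  \<comment> \<open>The unknowns are scaled: the first cubic is y^3 plus x times v0, v1, v2, the
    second is (y - 1)^3 plus x times v3, v4, v5. After division by x, \<open>r\<close> collects the
    constants and the quadratic terms; the latter retain a factor x, which makes the system
    contracting.\<close>
  define r where "r v = (\<lambda>l. [1 - fps_X * (v 0 * v 3), - 1 - fps_X * (v 0 * v 4 + v 1 * v 3),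
      - (fps_X * (v 0 * v 5 + v 1 * v 4 + v 2 * v 3)), 1 - fps_X * (v 1 * v 5 + v 2 * v 4),
      - (fps_X * (v 2 * v 5))] ! l)" for v :: "nat \<Rightarrow> 'a fps"
  define A where "A v = (let t = r v; \<alpha>0 = - t 0; \<alpha>1 = 3 * \<alpha>0 - t 1; \<alpha>2 = 3 * \<alpha>1
      - 3 * \<alpha>0 - t 2
     in [\<alpha>0, \<alpha>1, \<alpha>2, t 3 - \<alpha>0 + 3 * \<alpha>1 - 3 * \<alpha>2, t 4 - \<alpha>1 + 3 *
         \<alpha>2, - \<alpha>2])" for v
  define \<Phi> where "\<Phi> v i = (if i < 6 then A v ! i else 0)" for v i
  have "fps_agree (Suc n) (\<Phi> u i) (\<Phi> v i)" if "\<And>i. fps_agree n (u i) (v i)" for u v n i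
  proof -
    have "i < 6 \<Longrightarrow> i = 0 \<or> i = 1 \<or> i = 2 \<or> i = 3 \<or> i = 4 \<or> i = 5" by auto
    moreover note fps_agree_X_mult fps_agree_add fps_agree_diff fps_agree_uminus fps_agree_mult fps_agree_refl that
    ultimately show ?thesis
      by (auto simp: \<Phi>_def A_def r_def Let_def intro!: fps_agree_X_mult fps_agree_add fps_agree_diff
          fps_agree_uminus fps_agree_mult that)
  qed
  then obtain v where fixv: "\<Phi> v = v" using fps_contraction_fixpoint [of \<Phi>] by blast
  have v: "v i = A v ! i" if "i < 6" for i
    using fun_cong [OF fixv, of i] that by (simp add: \<Phi>_def)
  define t0 t1 t2 t3 t4 where t: "t0 = r v 0" "t1 = r v 1" "t2 = r v 2" "t3 = r v 3" "t4 = r v 4"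
  define X :: "'a fps" where "X = fps_X"
  have v0: "v 0 = - t0" and v1: "v 1 = 3 * v 0 - t1" and v2: "v 2 = 3 * v 1 - 3 * v 0 - t2"
    and v3: "v 3 = t3 - v 0 + 3 * v 1 - 3 * v 2" and v4: "v 4 = t4 - v 1 + 3 * v 2" and v5: "v 5 = - v 2"
    using v [of 0] v [of 1] v [of 2] v [of 3] v [of 4] v [of 5] by (simp_all add: A_def Let_def t)
  have t0: "t0 = 1 - X * (v 0 * v 3)" and t1: "t1 = - 1 - X * (v 0 * v 4 + v 1 * v 3)"
    and t2: "t2 = - (X * (v 0 * v 5 + v 1 * v 4 + v 2 * v 3))"
    and t3: "t3 = 1 - X * (v 1 * v 5 + v 2 * v 4)" and t4: "t4 = - (X * (v 2 * v 5))"
    by (simp_all add: t r_def X_def)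
  have e1: "3 * v 0 - v 1 + X * (v 0 * v 4 + v 1 * v 3) = - 1"
    and e2: "3 * v 1 - 3 * v 0 - v 2 + X * (v 0 * v 5 + v 1 * v 4 + v 2 * v 3) = 0"
    and e3: "v 0 - 3 * v 1 + 3 * v 2 + v 3 + X * (v 1 * v 5 + v 2 * v 4) = 1"
    and e4: "v 1 + v 4 - 3 * v 2 + X * (v 2 * v 5) = 0"
  proof -
    have d: "3 * v 0 - v 1 = t1" using v1 by simp
    show "3 * v 0 - v 1 + X * (v 0 * v 4 + v 1 * v 3) = - 1" unfolding d by (simp add: t1)
    have d: "3 * v 1 - 3 * v 0 - v 2 = t2" using v2 by simp
    show "3 * v 1 - 3 * v 0 - v 2 + X * (v 0 * v 5 + v 1 * v 4 + v 2 * v 3) = 0" unfolding d by (simp add: t2)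
    have d: "v 0 - 3 * v 1 + 3 * v 2 + v 3 = t3" unfolding v3 by simp
    show "v 0 - 3 * v 1 + 3 * v 2 + v 3 + X * (v 1 * v 5 + v 2 * v 4) = 1" unfolding d by (simp add: t3)
    have d: "v 1 + v 4 - 3 * v 2 = t4" unfolding v4 by simp
    show "v 1 + v 4 - 3 * v 2 + X * (v 2 * v 5) = 0" unfolding d by (simp add: t4)
  qed
  have v0': "- v 0 = t0" using v0 by simp
  show thesis
  proof (rule that [of "X * v 0" "X * v 3 - 1" "X * v 4 + 3" "X * v 1" "X * v 5 - 3" "X * v 2"])
    have "X * v 0 * (X * v 3 - 1) = X * (- v 0 + X * (v 0 * v 3))" by algebra
    also have "- v 0 + X * (v 0 * v 3) = 1" unfolding v0' by (simp add: t0)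
    finally show "X * v 0 * (X * v 3 - 1) = fps_X" by (simp add: X_def)
    have "X * v 0 * (X * v 4 + 3) + X * v 1 * (X * v 3 - 1) = X * (3 * v 0 - v 1 + X * (v 0 * v 4 + v 1 * v 3))"
      by algebra
    then show "X * v 0 * (X * v 4 + 3) + X * v 1 * (X * v 3 - 1) = - fps_X"
      unfolding e1 by (simp add: X_def)
    have "X * v 0 * (X * v 5 - 3) + X * v 1 * (X * v 4 + 3) + X * v 2 * (X * v 3 - 1) =
      X * (3 * v 1 - 3 * v 0 - v 2 + X * (v 0 * v 5 + v 1 * v 4 + v 2 * v 3))"
      by algebra
    then show "X * v 0 * (X * v 5 - 3) + X * v 1 * (X * v 4 + 3) + X * v 2 * (X * v 3 - 1) = 0"
      unfolding e2 by simp
    have "X * v 0 + (X * v 3 - 1) + X * v 1 * (X * v 5 - 3) + X * v 2 * (X * v 4 + 3) =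
      X * (v 0 - 3 * v 1 + 3 * v 2 + v 3 + X * (v 1 * v 5 + v 2 * v 4)) - 1"
      by algebra
    then show "X * v 0 + (X * v 3 - 1) + X * v 1 * (X * v 5 - 3) + X * v 2 * (X * v 4 + 3) = fps_X - 1"
      unfolding e3 by (simp add: X_def)
    have "X * v 1 + (X * v 4 + 3) + X * v 2 * (X * v 5 - 3) = X * (v 1 + v 4 - 3 * v 2 + X * (v 2 * v 5)) + 3"
      by algebra
    then show "X * v 1 + (X * v 4 + 3) + X * v 2 * (X * v 5 - 3) = 3"
      unfolding e4 by simp
    show "X * v 2 + (X * v 5 - 3) = - 3" using v5 by simp
  qed (simp_all add: X_def)
qed

text \<open>The indexed letters are the coefficients of the two cubics, y^2 + b y + c is the
  quotient that arises in \<open>kernel_solution\<close>, and f is \<open>F $ 0\<close>. Multiplied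
  by the first cubic, the quotient gives a quintic whose coefficients involve \<open>F $ 1\<close>
  and \<open>F $ 2\<close>. Free of these are its constant term, its value at 1, and its derivative
  at 1 plus its coefficient of y; after cancelling \<open>a0\<close> in the first, they are the
  hypotheses \<open>c\<close>, \<open>v\<close> and \<open>d\<close>. They are linear in b, c, f,
  and solving for f gives \<open>f * w = a0 - q\<close>, against which the expected answer h is
  checked.\<close>

lemma factor_relation:
  fixes x a0 a1 a2 b0 b1 b2 b c f :: "'a :: idom"
  assumes e0: "a0 * b0 = x"
    and e1: "a0 * b1 + a1 * b0 = - x"
    and e2: "a0 * b2 + a1 * b1 + a2 * b0 = 0"
    and e3: "a0 + b0 + a1 * b2 + a2 * b1 = x - 1"
    and e4: "a1 + b1 + a2 * b2 = 3"
    and e5: "a2 + b2 = - 3"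
    and c: "c = - b0 * f"
    and v: "(1 + a2 + a1 + a0) * (1 + b + c) = - x * f"
    and d: "2 * (a1 * c + a0 * b) + 2 * (a2 * c + a1 * b + a0) + 3 * (c + a2 * b + a1) + 4 * (b + a2) + 5 = - x * f"
    and nz: "1 + a2 + a1 + a0 \<noteq> 0" "1 + a2 + a1 \<noteq> 0"
  shows "x * f = (b1 - a1) + (b2 - a2)"
proof -
  \<comment> \<open>The values of the two cubics at 1. Their product is the kernel at 1, which is
    x.\<close>
  define q Q where "q = 1 + a2 + a1 + a0" and "Q = 1 + b2 + b1 + b0"
  define h where "h = (b1 - a1) + (b2 - a2)"
  define w where "w = a0 * b1 + q * (3 + 2 * b2 + b1) - a0 * Q + q * b0"
  have b2: "b2 = - 3 - a2" unfolding e5 [symmetric] by simp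
  have b1: "b1 = 3 - a1 - a2 * b2" unfolding e4 [symmetric] by simp
  have b0: "b0 = x - 1 - a0 - a1 * b2 - a2 * b1" unfolding e3 [symmetric] by simp
  have qQ: "q * Q = x"
  proof -
    have "q * Q = 1 + (a2 + b2) + (a1 + b1 + a2 * b2) + (a0 + b0 + a1 * b2 + a2 * b1)
        + (a0 * b2 + a1 * b1 + a2 * b0) + (a0 * b1 + a1 * b0) + a0 * b0"
      unfolding q_def Q_def by algebra
    then show ?thesis unfolding e0 e1 e2 e3 e4 e5 by simp
  qed
  have "q * (1 + b + c) = q * (- Q * f)"
    using v unfolding qQ [symmetric] q_def by (simp add: mult.assoc)
  then have "1 + b + c = - Q * f"
    using nz(1) mult_left_cancel [of q] unfolding q_def [symmetric] by blast
  then have bc: "b = - Q * f - 1 - c"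
    by (simp add: eq_diff_eq add_ac)
  have "f * w = a0 - q"
  proof -
    \<comment> \<open>Product rule at 1: \<open>A1\<close> and \<open>2 + b\<close> are the
      derivatives of the first cubic and of y^2 + b y + c. Likewise
      \<open>A1 * Q + q * (3 + 2 * b2 + b1)\<close> is the derivative of the kernel, known from its
      coefficients.\<close>
    define A1 where "A1 = 3 + 2 * a2 + a1"
    have "2 * (a1 * c + a0 * b) + 2 * (a2 * c + a1 * b + a0) + 3 * (c + a2 * b + a1) + 4 * (b + a2) + 5
        = a1 * c + a0 * b + A1 * (1 + b + c) + q * (2 + b)"
      unfolding A1_def q_def by algebra
    also have "\<dots> = f * (- (a1 * b0 + a0 * b1) - (A1 * Q + q * (3 + 2 * b2 + b1)) + a0 * b0 - q * Q + w) - a0 + q"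
      unfolding bc c w_def by algebra
    also have "A1 * Q + q * (3 + 2 * b2 + b1) = 6 + 5 * (a2 + b2) + 4 * (a1 + b1 + a2 * b2)
        + 3 * (a0 + b0 + a1 * b2 + a2 * b1) + 2 * (a0 * b2 + a1 * b1 + a2 * b0) + (a0 * b1 + a1 * b0)"
      unfolding A1_def q_def Q_def by algebra
    finally have "- x * f = f * (- (- x) - (6 + 5 * (- 3) + 4 * 3 + 3 * (x - 1) + 2 * 0 + - x) + x - x + w) - a0 + q"
      unfolding e0 e1 e2 e3 e4 e5 qQ add.commute [of "a1 * b0"] d .
    then have "f * w - (a0 - q) = 0" by algebra
    then show ?thesis by simp
  qed
  text \<open>The cofactor comes from a reduction modulo e0, e1, e2 after eliminating b0, b1, b2.\<close>
  have "h * w - x * (a0 - q) =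
      (a2^2 + a2 - 2 * a1 + 1) * ((a0 * b1 + a1 * b0 + x) + (a0 * b2 + a1 * b1 + a2 * b0))"
    unfolding h_def w_def q_def Q_def b0 b1 b2 by algebra
  also have "\<dots> = 0" unfolding e1 e2 by simp
  finally have "h * w = x * f * w"
    unfolding \<open>f * w = a0 - q\<close> [symmetric] by algebra
  moreover have "w \<noteq> 0"
  proof
    assume "w = 0"
    moreover have "a0 - q = - (1 + a2 + a1)" by (simp add: q_def)
    ultimately show False
      using \<open>f * w = a0 - q\<close> nz(2) by (metis mult_zero_right neg_equal_0_iff_equal)
  qed
  ultimately show ?thesis unfolding h_def by simp
qed

text \<open>The kernel method without roots. With A and B the two cubics, G = B F satisfies A G = a
  polynomial of degree 6 in y; since A is y^3 modulo x, this forces G to be a cubic polynomial,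
  which replaces the insertion of the small roots. The factor y - 1 of the right side passes to G,
  and the remaining quotient is quadratic.\<close>

lemma kernel_solution:
  fixes F :: "'a :: idom fps fps" and a0 a1 a2 b0 b1 b2 :: "'a fps"
  assumes F: "(fps_X ^ 3 * (fps_X - 1) ^ 3 + fps_const fps_X * (1 - fps_X + fps_X ^ 3)) * F =
    (fps_X - 1) * (fps_X ^ 3 * (1 - fps_X)^2 - fps_const fps_X * (fps_const (F $ 0) * (1 - fps_X ^ 3 * (1 - fps_X))
      + fps_const (F $ 1) * (fps_X * (1 - fps_X) * (1 + fps_X - fps_X^2))
      + fps_const (F $ 2) * (fps_X^2 * (1 - fps_X)^2)))"
    and e0: "a0 * b0 = fps_X"
    and e1: "a0 * b1 + a1 * b0 = - fps_X"
    and e2: "a0 * b2 + a1 * b1 + a2 * b0 = 0"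
    and e3: "a0 + b0 + a1 * b2 + a2 * b1 = fps_X - 1"
    and e4: "a1 + b1 + a2 * b2 = 3"
    and e5: "a2 + b2 = - 3"
    and z: "a0 $ 0 = 0" "a1 $ 0 = 0" "a2 $ 0 = 0"
  shows "fps_X * (F $ 0) = (b1 - a1) + (b2 - a2)"
proof -
  define X :: "'a fps fps" where "X = fps_X"
  define x :: "'a fps" where "x = fps_X"
  define A where "A = X^3 + fps_const a2 * X^2 + fps_const a1 * X + fps_const a0"
  define B where "B = X^3 + fps_const b2 * X^2 + fps_const b1 * X + fps_const b0"
  define G where "G = B * F"
  \<comment> \<open>The right side is y - 1 times y^5 + R4 y^4 + R3 y^3 + R2 y^2 + R1 y +
    R0.\<close>
  define R0 R1 R2 R3 R4 where "R0 = - x * F $ 0" and "R1 = - x * F $ 1" and "R2 = - x * F $ 2"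
    and "R3 = 1 + x * (F $ 0 + 2 * F $ 1 + 2 * F $ 2)" and "R4 = - 2 - x * (F $ 0 + F $ 1 + F $ 2)"
  note R_defs = R0_def R1_def R2_def R3_def R4_def
  have "A * B = X^6 + fps_const (a2 + b2) * X^5 + fps_const (a1 + b1 + a2 * b2) * X^4
      + fps_const (a0 + b0 + a1 * b2 + a2 * b1) * X^3 + fps_const (a0 * b2 + a1 * b1 + a2 * b0) * X^2
      + fps_const (a0 * b1 + a1 * b0) * X + fps_const (a0 * b0)"
    unfolding A_def B_def fps_const_add [symmetric] fps_const_mult [symmetric] by algebra
  also have "\<dots> = X^3 * (X - 1)^3 + fps_const x * (1 - X + X^3)"
  proof -
    have c: "fps_const (x - 1) = fps_const x - 1" "fps_const (3 :: 'a fps) = 3"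
      "fps_const (- 3 :: 'a fps) = - 3" "fps_const (- x) = - fps_const x" "fps_const (0 :: 'a fps) = 0"
      by (simp_all flip: fps_const_sub add: numeral_fps_const)
    show ?thesis
      unfolding e0 e1 e2 e3 e4 e5 unfolding x_def [symmetric] unfolding c by algebra
  qed
  finally have "A * G = (X^3 * (X - 1)^3 + fps_const x * (1 - X + X^3)) * F"
    unfolding G_def by (simp only: mult.assoc [symmetric])
  also have "\<dots> = (X - 1) * (X ^ 3 * (1 - X)^2 - fps_const x * (fps_const (F $ 0) * (1 - X ^ 3 * (1 - X))
      + fps_const (F $ 1) * (X * (1 - X) * (1 + X - X^2)) + fps_const (F $ 2) * (X^2 * (1 - X)^2)))"
    using F unfolding X_def x_def .
  also have "\<dots> = (X - 1) * (X^5 + fps_const R4 * X^4 + fps_const R3 * X^3 + fps_const R2 * X^2 + fps_const R1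
      * X + fps_const R0)"
  proof -
    have R: "fps_const R0 = - fps_const x * fps_const (F $ 0)" "fps_const R1 = - fps_const x * fps_const (F $ 1)"
      "fps_const R2 = - fps_const x * fps_const (F $ 2)"
      "fps_const R3 = 1 + fps_const x * (fps_const (F $ 0) + 2 * fps_const (F $ 1) + 2 * fps_const (F $ 2))"
      "fps_const R4 = - 2 - fps_const x * (fps_const (F $ 0) + fps_const (F $ 1) + fps_const (F $ 2))"
      unfolding R_defs fps_const_neg [symmetric] fps_const_sub [symmetric] fps_const_add [symmetric] fps_const_mult
          [symmetric]
      by (simp_all add: numeral_fps_const fps_const_neg [symmetric] del: fps_const_neg)
    show ?thesis unfolding R by algebra
  qed
  also have "\<dots> = X^6 + fps_const (R4 - 1) * X^5 + fps_const (R3 - R4) * X^4 + fps_const (R2 - R3) * X^3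
      + fps_const (R1 - R2) * X^2 + fps_const (R0 - R1) * X + fps_const (- R0)"
    unfolding fps_const_sub [symmetric] fps_const_neg [symmetric] fps_const_1_eq_1 by algebra
  finally have AG: "A * G = \<dots>" .
  have AGn: "(A * G) $ n = (if n < 3 then 0 else G $ (n - 3)) + a2 * (if n < 2 then 0 else G $ (n - 2))
      + a1 * (if n < 1 then 0 else G $ (n - 1)) + a0 * G $ n" for n
    unfolding A_def X_def by (simp add: ring_distribs mult.assoc fps_X_power_mult_nth)
  have coeff: "(A * G) $ n = (if n = 6 then 1 else if n = 5 then R4 - 1 else if n = 4 then R3 - R4 else
      if n = 3 then R2 - R3 else if n = 2 then R1 - R2 else if n = 1 then R0 - R1 else if n = 0 then - R0 else 0)" for n
    unfolding AG X_def by (simp add: fps_X_power_nth)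
  note AGc = trans [OF AGn [symmetric] coeff]
  text \<open>Since A is y^3 modulo x, the higher coefficients of G are divisible by every power of x.\<close>
  have "(G $ k) $ n = 0" if "k \<ge> 4" for n k
    using that
  proof (induction n arbitrary: k rule: less_induct)
    case (less n)
    have van: "(a * g) $ n = 0" if "a $ 0 = 0" "\<And>j. j < n \<Longrightarrow> g $ j = 0" for a g :: "'a fps"
      unfolding fps_mult_nth
    proof (intro sum.neutral ballI)
      fix i assume "i \<in> {0..n}"
      then show "a $ i * g $ (n - i) = 0"
        using that by (cases "i = 0") auto
    qed
    have "G $ k + (a2 * G $ (k + 1) + a1 * G $ (k + 2) + a0 * G $ (k + 3)) = 0"
      using AGc [of "k + 3"] less.prems by (simp add: add.assoc)
    then have "G $ k = - (a2 * G $ (k + 1) + a1 * G $ (k + 2) + a0 * G $ (k + 3))"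
      by (simp only: eq_neg_iff_add_eq_0)
    then show ?case
      using van [OF z(3), of "G $ (k + 1)"] van [OF z(2), of "G $ (k + 2)"] van [OF z(1), of "G $ (k + 3)"] less
      by simp
  qed
  then have G4: "G $ k = 0" if "k \<ge> 4" for k
    using that by (intro fps_ext) simp
  have g3: "G $ 3 = 1"
    using AGc [of 6] G4 by simp
  have r0: "a0 * G $ 0 = - R0"
    using AGc [of 0] by simp
  have r1: "a1 * G $ 0 + a0 * G $ 1 = R0 - R1"
    using AGc [of 1] by simp
  have r2: "a2 * G $ 0 + a1 * G $ 1 + a0 * G $ 2 = R1 - R2"
    using AGc [of 2] by simp
  have r3: "G $ 0 + a2 * G $ 1 + a1 * G $ 2 + a0 = R2 - R3"
    using AGc [of 3] g3 by simp
  have r4: "G $ 1 + a2 * G $ 2 + a1 = R3 - R4"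
    using AGc [of 4] g3 G4 by simp
  have r5: "G $ 2 + a2 = R4 - 1"
    using AGc [of 5] g3 G4 by simp
  have "(1 + a2 + a1 + a0) $ 0 \<noteq> 0" "(1 + a2 + a1) $ 0 \<noteq> 0"
    by (simp_all add: z)
  then have nz: "1 + a2 + a1 + a0 \<noteq> 0" "1 + a2 + a1 \<noteq> 0"
    by (metis fps_zero_nth)+
  \<comment> \<open>This is A(1) G(1) = 0, the right side being divisible by y - 1; A(1) is nonzero
    since it is 1 modulo x.\<close>
  have "(1 + a2 + a1 + a0) * (G $ 0 + G $ 1 + G $ 2 + 1) = 0"
    using r0 r1 r2 r3 r4 r5 by algebra
  with nz(1) have "G $ 0 + G $ 1 + G $ 2 + 1 = 0"
    by (metis mult_eq_0_iff)
  moreover have "G $ 1 = (G $ 0 + G $ 1 + G $ 2 + 1) - (G $ 0) - G $ 2 - 1" by simp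
  ultimately have sum: "G $ 1 = - (G $ 0) - G $ 2 - 1" by simp
  have g0: "G $ 0 = b0 * F $ 0"
    by (simp add: G_def B_def X_def)
  have "x * F $ 0 = (b1 - a1) + (b2 - a2)"
  \<comment> \<open>G is y - 1 times y^2 + (\<open>G $ 2\<close> + 1) y - \<open>G $ 0\<close>,
    which gives the instances of b and c.\<close>
  proof (rule factor_relation [of a0 b0 x b1 a1 b2 a2 "- (G $ 0)" "F $ 0" "G $ 2 + 1"])
    show "- (G $ 0) = - b0 * F $ 0" by (simp add: g0)
    have s0: "a0 * - (G $ 0) = R0" using r0 by simp
    have "a1 * - (G $ 0) + a0 * (G $ 2 + 1) = - (a1 * G $ 0 + a0 * G $ 1) - a0 * G $ 0"
      unfolding sum by algebra
    then have s1: "a1 * - (G $ 0) + a0 * (G $ 2 + 1) = R1" unfolding r0 r1 by simp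
    have "a2 * - (G $ 0) + a1 * (G $ 2 + 1) + a0 =
        - (a2 * G $ 0 + a1 * G $ 1 + a0 * G $ 2) + (a1 * - (G $ 0) + a0 * (G $ 2 + 1))"
      unfolding sum by algebra
    then have s2: "a2 * - (G $ 0) + a1 * (G $ 2 + 1) + a0 = R2" unfolding r2 s1 by simp
    have "- (G $ 0) + a2 * (G $ 2 + 1) + a1 =
        - (G $ 0 + a2 * G $ 1 + a1 * G $ 2 + a0) + (a2 * - (G $ 0) + a1 * (G $ 2 + 1) + a0)"
      unfolding sum by algebra
    then have s3: "- (G $ 0) + a2 * (G $ 2 + 1) + a1 = R3" unfolding r3 s2 by simp
    have "G $ 2 + 1 + a2 = (G $ 2 + a2) + 1" by simp
    then have s4: "G $ 2 + 1 + a2 = R4" unfolding r5 by simp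
    have "(1 + a2 + a1 + a0) * (1 + (G $ 2 + 1) + - (G $ 0)) =
        (a0 * - (G $ 0)) + (a1 * - (G $ 0) + a0 * (G $ 2 + 1)) + (a2 * - (G $ 0) + a1 * (G $ 2 + 1) + a0)
        + (- (G $ 0) + a2 * (G $ 2 + 1) + a1) + (G $ 2 + 1 + a2) + 1"
      by algebra
    also have "\<dots> = - x * F $ 0"
      unfolding s0 s1 s2 s3 s4 unfolding R_defs by algebra
    finally show "(1 + a2 + a1 + a0) * (1 + (G $ 2 + 1) + - (G $ 0)) = - x * F $ 0" .
    show "2 * (a1 * - (G $ 0) + a0 * (G $ 2 + 1)) + 2 * (a2 * - (G $ 0) + a1 * (G $ 2 + 1) + a0)
        + 3 * (- (G $ 0) + a2 * (G $ 2 + 1) + a1) + 4 * (G $ 2 + 1 + a2) + 5 = - x * F $ 0"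
      unfolding s1 s2 s3 s4 unfolding R_defs by algebra
  qed (use e0 e1 e2 e3 e4 e5 nz in \<open>simp_all add: x_def\<close>)
  then show ?thesis by (simp add: x_def)
qed

section \<open>Elimination\<close>

instance fps :: (ring_char_0) ring_char_0 ..

lemma numeral_mult_cancelD:
  fixes a b :: "'a :: {idom, ring_char_0}"
  shows "numeral n * a = numeral n * b \<Longrightarrow> a = b"
  by simp

lemma numeral_mult_eq_0D:
  fixes a :: "'a :: {idom, ring_char_0}"
  shows "numeral n * a = 0 \<Longrightarrow> a = 0"
  by simp

text \<open>Exchanging the cubics does not change \<open>y\<close>, so \<open>y\<close> has one
  value for each of the ten ways to split six kernel roots into two triples; hence the degree. The
  elimination takes place among the exchange-invariant expressions, by an explicit table for
  multiplication by \<open>y\<close>.\<close>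

lemma shrub_elimination:
  fixes x a0 a1 a2 b0 b1 b2 y :: "'a :: {idom, ring_char_0}"
  assumes e0: "a0 * b0 = x"
    and e1: "a0 * b1 + a1 * b0 = - x"
    and e2: "a0 * b2 + a1 * b1 + a2 * b0 = 0"
    and e3: "a0 + b0 + a1 * b2 + a2 * b1 = x - 1"
    and e4: "a1 + b1 + a2 * b2 = 3"
    and e5: "a2 + b2 = - 3"
    and y: "y = (b1 - a1 + (b2 - a2))^2"
  shows "y^10 + (18*x) * y^9 + (123*x^2) * y^8 + (- (3*x^4) + 420*x^3 + 54*x^2) * y^7 + (- (36*x^5) + 751*x^4 +
      486*x^3) * y^6 + (- (138*x^6) + 354*x^5 + 1053*x^4) * y^5 + (3*x^8 - 228*x^7 - 213*x^6 + 162*x^5 + 729*x^4) *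
      y^4 + (18*x^9 - 215*x^8 + 2*x^7 - 360*x^6) * y^3 + (15*x^10 + 24*x^9 - 71*x^8 - 54*x^7) * y^2 + (- (x^12) +
      24*x^11 - 8*x^10 + 54*x^9 - x^8) * y + (4*x^12 + 4*x^11 + x^10) = 0"
proof -
  define s where "s = a1 + b1"
  define z where "z = a0 + b0"
  define k where "k = a1 * b1"
  define d0 where "d0 = a0 - b0"
  define d1 where "d1 = a1 - b1"
  define d2 where "d2 = a2 - b2"
  have c2: "a2 * b2 = 3 - s"
    unfolding s_def e4 [symmetric] by algebra
  have c3: "a1 * b2 + a2 * b1 = x - 1 - z"
    unfolding z_def e3 [symmetric] by algebra
  have c4: "a0 * b2 + a2 * b0 = - k"
    unfolding k_def using e2 by algebra
  \<comment> \<open>A product of two differences is invariant under the exchange and hence a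
    polynomial in x, s, z, k. Each identity between products of four differences thus yields a
    relation between s, z and k.\<close>
  have "d2 * d2 = (a2 + b2)^2 - 4 * (a2 * b2)"
    unfolding d0_def d1_def d2_def s_def z_def k_def by algebra
  then have dw: "d2 * d2 = 4*s - 3"
    unfolding e5 c2 by algebra
  have "d2 * d1 = (a2 + b2) * s - 2 * (a1 * b2 + a2 * b1)"
    unfolding d0_def d1_def d2_def s_def z_def k_def by algebra
  then have dm: "d2 * d1 = - (2*x) - 3*s + 2*z + 2"
    unfolding e5 c3 by algebra
  have "d1 * d1 = s^2 - 4 * k"
    unfolding d0_def d1_def d2_def s_def z_def k_def by algebra
  then have de: "d1 * d1 = s^2 - 4*k" by simp
  have "d2 * d0 = (a2 + b2) * z - 2 * (a0 * b2 + a2 * b0)"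
    unfolding d0_def d1_def d2_def s_def z_def k_def by algebra
  then have dX: "d2 * d0 = - (3*z) + 2*k"
    unfolding e5 c4 by algebra
  have "d1 * d0 = s * z - 2 * (a0 * b1 + a1 * b0)"
    unfolding d0_def d1_def d2_def s_def z_def k_def by algebra
  then have dn: "d1 * d0 = 2*x + s*z"
    unfolding e1 by algebra
  have "d0 * d0 = z^2 - 4 * (a0 * b0)"
    unfolding d0_def d1_def d2_def s_def z_def k_def by algebra
  then have dq: "d0 * d0 = - (4*x) + z^2"
    unfolding e0 by algebra
  text \<open>The elements s, z and k generate the subring of elements that are invariant under exchanging the
    two cubic factors; it has rank 10 over the polynomials in x. Its relations are the vanishing
    2x2 minors of the matrix of products of d0, d1, d2.\<close>
  have r1: "- (x^2) - 3*x*s + 2*x*z + 2*x + s^3 - 3*s^2 + 3*s*z - 4*s*k + 3*s - z^2 - 2*z + 3*k - 1 = 0"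
  proof -
    have "(d2 * d2) * (d1 * d1) - (d2 * d1) * (d2 * d1) = 0" by simp
    then have "4 * (- (x^2) - 3*x*s + 2*x*z + 2*x + s^3 - 3*s^2 + 3*s*z - 4*s*k + 3*s - z^2 - 2*z + 3*k - 1) = 0"
        unfolding dw de dm by algebra
    then show ?thesis by (rule numeral_mult_eq_0D)
  qed
  have r2: "4*x*s - 3*x*z + 2*x*k - 3*x + 2*s^2*z - 6*s*z + 3*s*k + 3*z^2 - 2*z*k + 3*z - 2*k = 0"
  proof -
    have "(d2 * d2) * (d1 * d0) - (d2 * d1) * (d2 * d0) = 0" by simp
    then have "2 * (4*x*s - 3*x*z + 2*x*k - 3*x + 2*s^2*z - 6*s*z + 3*s*k + 3*z^2 - 2*z*k + 3*z - 2*k) = 0"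
        unfolding dw dn dm dX by algebra
    then show ?thesis by (rule numeral_mult_eq_0D)
  qed
  have r3: "- (4*x*s) + 3*x + s*z^2 - 3*z^2 + 3*z*k - k^2 = 0"
  proof -
    have "(d2 * d2) * (d0 * d0) - (d2 * d0) * (d2 * d0) = 0" by simp
    then have "4 * (- (4*x*s) + 3*x + s*z^2 - 3*z^2 + 3*z*k - k^2) = 0" unfolding dw dq dX by algebra
    then show ?thesis by (rule numeral_mult_eq_0D)
  qed
  have r4: "- (2*x^2) - x*s*z - 3*x*s + 2*x*z + 2*x - s^2*k + s*z^2 + s*z - 6*z*k + 4*k^2 = 0"
  proof -
    have "(d2 * d1) * (d1 * d0) - (d1 * d1) * (d2 * d0) = 0" by simp
    then have "2 * (- (2*x^2) - x*s*z - 3*x*s + 2*x*z + 2*x - s^2*k + s*z^2 + s*z - 6*z*k + 4*k^2) = 0" unfolding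
        dm dn de dX by algebra
    then show ?thesis by (rule numeral_mult_eq_0D)
  qed
  have r5: "4*x^2 + 6*x*s - x*z^2 - x*z - 2*x*k - 4*x - s*z*k + z^3 + z^2 = 0"
  proof -
    have "(d2 * d1) * (d0 * d0) - (d1 * d0) * (d2 * d0) = 0" by simp
    then have "2 * (4*x^2 + 6*x*s - x*z^2 - x*z - 2*x*k - 4*x - s*z*k + z^3 + z^2) = 0" unfolding dm dq dn dX by algebra
    then show ?thesis by (rule numeral_mult_eq_0D)
  qed
  have r6: "- (x^2) - x*s^2 - x*s*z + 4*x*k - z^2*k = 0"
  proof -
    have "(d1 * d1) * (d0 * d0) - (d1 * d0) * (d1 * d0) = 0" by simp
    then have "4 * (- (x^2) - x*s^2 - x*s*z + 4*x*k - z^2*k) = 0" unfolding de dq dn by algebra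
    then show ?thesis by (rule numeral_mult_eq_0D)
  qed
  have y0: "y = - (4*x) + s^2 - 2*s + 4*z - 4*k + 1"
  proof -
    have "y = d1 * d1 + 2 * (d2 * d1) + d2 * d2" unfolding y d1_def d2_def by algebra
    then show ?thesis unfolding dw dm de by algebra
  qed
  \<comment> \<open>In this and the following identities the right side combines the left sides of
    \<open>r1\<close> to \<open>r6\<close>, so unfolding these makes it vanish. What remains is the
    normal form of \<open>y\<close> times a basis element; factors 2 and 4 clear its
    denominators.\<close>
  have "s * (- (4*x) + s^2 - 2*s + 4*z - 4*k + 1) - (x^2 - x*s - 2*x*z - 2*x + s^2 + s*z - 2*s + z^2 + 2*z - 3*k + 1) =
    (1) * (- (x^2) - 3*x*s + 2*x*z + 2*x + s^3 - 3*s^2 + 3*s*z - 4*s*k + 3*s - z^2 - 2*z + 3*k - 1)" by algebra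
  then have t1: "(s * y) = x^2 - x*s - 2*x*z - 2*x + s^2 + s*z - 2*s + z^2 + 2*z - 3*k + 1" unfolding r1 y0 by algebra
  have "2 * (z * (- (4*x) + s^2 - 2*s + 4*z - 4*k + 1)) - (- (4*x*s) - 5*x*z - 2*x*k + 3*x + 2*s*z - 3*s*k + 5*z^2
      - 6*z*k - z + 2*k) =
    (1) * (4*x*s - 3*x*z + 2*x*k - 3*x + 2*s^2*z - 6*s*z + 3*s*k + 3*z^2 - 2*z*k + 3*z - 2*k)" by algebra
  then have t2: "2 * (z * y) = - (4*x*s) - 5*x*z - 2*x*k + 3*x + 2*s*z - 3*s*k + 5*z^2 - 6*z*k - z + 2*k" unfolding
      r2 y0 by algebra
  have "2 * (s^2 * (- (4*x) + s^2 - 2*s + 4*z - 4*k + 1)) - (2*x^2*s + 2*x^2 - 2*x*s^2 - 4*x*s*z - 2*x*s - x*z -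
      2*x*k - x + 2*s^2 + 2*s*z^2 + 4*s*z - s*k - 4*s - z^2 + 2*z*k + z - 4*k + 2) =
    (2*s + 2) * (- (x^2) - 3*x*s + 2*x*z + 2*x + s^3 - 3*s^2 + 3*s*z - 4*s*k + 3*s - z^2 - 2*z + 3*k - 1) + (1) *
        (4*x*s - 3*x*z + 2*x*k - 3*x + 2*s^2*z - 6*s*z + 3*s*k + 3*z^2 - 2*z*k + 3*z - 2*k)" by algebra
  then have t3: "2 * (s^2 * y) = 2*x^2*s + 2*x^2 - 2*x*s^2 - 4*x*s*z - 2*x*s - x*z - 2*x*k - x + 2*s^2 + 2*s*z^2 +
      4*s*z - s*k - 4*s - z^2 + 2*z*k + z - 4*k + 2" unfolding r1 r2 y0 by algebra
  have "k * (- (4*x) + s^2 - 2*s + 4*z - 4*k + 1) - (- (2*x^2) - x*s*z - 3*x*s + 2*x*z - 4*x*k + 2*x + s*z^2 + s*z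
      - 2*s*k - 2*z*k + k) =
    (- (1)) * (- (2*x^2) - x*s*z - 3*x*s + 2*x*z + 2*x - s^2*k + s*z^2 + s*z - 6*z*k + 4*k^2)" by algebra
  then have t4: "(k * y) = - (2*x^2) - x*s*z - 3*x*s + 2*x*z - 4*x*k + 2*x + s*z^2 + s*z - 2*s*k - 2*z*k + k"
      unfolding r4 y0 by algebra
  have "8 * (s*z * (- (4*x) + s^2 - 2*s + 4*z - 4*k + 1)) - (6*x^2*z - 18*x^2 - 4*x*s^2 - 8*x*s*z - 2*x*s*k + 8*x*s
      - 6*x*z^2 + 4*x*k - 6*x - 4*s*z^2 + 8*s*z - 10*s*k + 30*z^2 - 28*z*k - 6*z + 8*k) =
    (6*z) * (- (x^2) - 3*x*s + 2*x*z + 2*x + s^3 - 3*s^2 + 3*s*z - 4*s*k + 3*s - z^2 - 2*z + 3*k - 1) + (s + 4) *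
        (4*x*s - 3*x*z + 2*x*k - 3*x + 2*s^2*z - 6*s*z + 3*s*k + 3*z^2 - 2*z*k + 3*z - 2*k) + (12) * (- (4*x*s) +
        3*x + s*z^2 - 3*z^2 + 3*z*k - k^2) + (3) * (- (2*x^2) - x*s*z - 3*x*s + 2*x*z + 2*x - s^2*k + s*z^2 + s*z -
        6*z*k + 4*k^2) + (6) * (4*x^2 + 6*x*s - x*z^2 - x*z - 2*x*k - 4*x - s*z*k + z^3 + z^2)" by algebra
  then have "2 * (4 * (s*z * y)) = 2 * (3*x^2*z - 9*x^2 - 2*x*s^2 - 4*x*s*z - x*s*k + 4*x*s - 3*x*z^2 + 2*x*k - 3*x
      - 2*s*z^2 + 4*s*z - 5*s*k + 15*z^2 - 14*z*k - 3*z + 4*k)" unfolding r1 r2 r3 r4 r5 y0 by algebra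
  then have t5: "4 * (s*z * y) = 3*x^2*z - 9*x^2 - 2*x*s^2 - 4*x*s*z - x*s*k + 4*x*s - 3*x*z^2 + 2*x*k - 3*x -
      2*s*z^2 + 4*s*z - 5*s*k + 15*z^2 - 14*z*k - 3*z + 4*k" by (rule numeral_mult_cancelD)
  have "8 * (z^2 * (- (4*x) + s^2 - 2*s + 4*z - 4*k + 1)) - (- (2*x^2*z) - 42*x^2 + 20*x*s^2 + 8*x*s*z - 2*x*s*k -
      48*x*s + 2*x*z^2 - 8*x*z*k + 28*x*z - 60*x*k + 30*x - 4*s*z^2 + 2*s*k + 10*z^2 - 4*z*k - 2*z) =
    (- (2*z)) * (- (x^2) - 3*x*s + 2*x*z + 2*x + s^3 - 3*s^2 + 3*s*z - 4*s*k + 3*s - z^2 - 2*z + 3*k - 1) + (s +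
        4*z) * (4*x*s - 3*x*z + 2*x*k - 3*x + 2*s^2*z - 6*s*z + 3*s*k + 3*z^2 - 2*z*k + 3*z - 2*k) + (12) * (-
        (4*x*s) + 3*x + s*z^2 - 3*z^2 + 3*z*k - k^2) + (3) * (- (2*x^2) - x*s*z - 3*x*s + 2*x*z + 2*x - s^2*k +
        s*z^2 + s*z - 6*z*k + 4*k^2) + (18) * (4*x^2 + 6*x*s - x*z^2 - x*z - 2*x*k - 4*x - s*z*k + z^3 + z^2) +
        (24) * (- (x^2) - x*s^2 - x*s*z + 4*x*k - z^2*k)" by algebra
  then have "2 * (4 * (z^2 * y)) = 2 * (- (x^2*z) - 21*x^2 + 10*x*s^2 + 4*x*s*z - x*s*k - 24*x*s + x*z^2 - 4*x*z*k
      + 14*x*z - 30*x*k + 15*x - 2*s*z^2 + s*k + 5*z^2 - 2*z*k - z)" unfolding r1 r2 r3 r4 r5 r6 y0 by algebra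
  then have t6: "4 * (z^2 * y) = - (x^2*z) - 21*x^2 + 10*x*s^2 + 4*x*s*z - x*s*k - 24*x*s + x*z^2 - 4*x*z*k +
      14*x*z - 30*x*k + 15*x - 2*s*z^2 + s*k + 5*z^2 - 2*z*k - z" by (rule numeral_mult_cancelD)
  have "8 * (s*k * (- (4*x) + s^2 - 2*s + 4*z - 4*k + 1)) - (- (2*x^2*z) + 8*x^2*k - 10*x^2 - 12*x*s^2 - 16*x*s*z -
      10*x*s*k + 16*x*s + 2*x*z^2 - 16*x*z*k + 12*x*z + 12*x*k - 10*x + 4*s*z^2 + 8*s*z - 14*s*k + 10*z^2 - 20*z*k
      - 2*z + 8*k) =
    (- (2*z) + 8*k) * (- (x^2) - 3*x*s + 2*x*z + 2*x + s^3 - 3*s^2 + 3*s*z - 4*s*k + 3*s - z^2 - 2*z + 3*k - 1) +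
        (s) * (4*x*s - 3*x*z + 2*x*k - 3*x + 2*s^2*z - 6*s*z + 3*s*k + 3*z^2 - 2*z*k + 3*z - 2*k) + (4) * (-
        (4*x*s) + 3*x + s*z^2 - 3*z^2 + 3*z*k - k^2) + (- (5)) * (- (2*x^2) - x*s*z - 3*x*s + 2*x*z + 2*x - s^2*k +
        s*z^2 + s*z - 6*z*k + 4*k^2) + (- (2)) * (4*x^2 + 6*x*s - x*z^2 - x*z - 2*x*k - 4*x - s*z*k + z^3 + z^2) +
        (- (8)) * (- (x^2) - x*s^2 - x*s*z + 4*x*k - z^2*k)" by algebra
  then have "2 * (4 * (s*k * y)) = 2 * (- (x^2*z) + 4*x^2*k - 5*x^2 - 6*x*s^2 - 8*x*s*z - 5*x*s*k + 8*x*s + x*z^2 -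
      8*x*z*k + 6*x*z + 6*x*k - 5*x + 2*s*z^2 + 4*s*z - 7*s*k + 5*z^2 - 10*z*k - z + 4*k)" unfolding r1 r2 r3 r4 r5
      r6 y0 by algebra
  then have t7: "4 * (s*k * y) = - (x^2*z) + 4*x^2*k - 5*x^2 - 6*x*s^2 - 8*x*s*z - 5*x*s*k + 8*x*s + x*z^2 -
      8*x*z*k + 6*x*z + 6*x*k - 5*x + 2*s*z^2 + 4*s*z - 7*s*k + 5*z^2 - 10*z*k - z + 4*k" by (rule
      numeral_mult_cancelD)
  have "32 * (z*k * (- (4*x) + s^2 - 2*s + 4*z - 4*k + 1)) - (32*x^2*s - 56*x^2*z - 216*x^2 + 144*x*s^2 -
      32*x*s*z^2 + 160*x*s*z - 24*x*s*k - 320*x*s + 152*x*z^2 - 128*x*z*k + 32*x*z - 272*x*k + 184*x - 16*s*z^2 +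
      8*s*k + 40*z^2 - 16*z*k - 8*z) =
    (48*x + 24*s*z - 62*z + 36*k) * (- (x^2) - 3*x*s + 2*x*z + 2*x + s^3 - 3*s^2 + 3*s*z - 4*s*k + 3*s - z^2 - 2*z
        + 3*k - 1) + (18*x - 12*s^2 + 31*s - 24*z + 52*k - 18) * (4*x*s - 3*x*z + 2*x*k - 3*x + 2*s^2*z - 6*s*z +
        3*s*k + 3*z^2 - 2*z*k + 3*z - 2*k) + (8*x + 12*s + 24*z + 40) * (- (4*x*s) + 3*x + s*z^2 - 3*z^2 + 3*z*k -
        k^2) + (- (24*x) + 9) * (- (2*x^2) - x*s*z - 3*x*s + 2*x*z + 2*x - s^2*k + s*z^2 + s*z - 6*z*k + 4*k^2) +
        (82) * (4*x^2 + 6*x*s - x*z^2 - x*z - 2*x*k - 4*x - s*z*k + z^3 + z^2) + (112) * (- (x^2) - x*s^2 - x*s*z +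
        4*x*k - z^2*k)" by algebra
  then have "8 * (4 * (z*k * y)) = 8 * (4*x^2*s - 7*x^2*z - 27*x^2 + 18*x*s^2 - 4*x*s*z^2 + 20*x*s*z - 3*x*s*k -
      40*x*s + 19*x*z^2 - 16*x*z*k + 4*x*z - 34*x*k + 23*x - 2*s*z^2 + s*k + 5*z^2 - 2*z*k - z)" unfolding r1 r2 r3
      r4 r5 r6 y0 by algebra
  then have t8: "4 * (z*k * y) = 4*x^2*s - 7*x^2*z - 27*x^2 + 18*x*s^2 - 4*x*s*z^2 + 20*x*s*z - 3*x*s*k - 40*x*s +
      19*x*z^2 - 16*x*z*k + 4*x*z - 34*x*k + 23*x - 2*s*z^2 + s*k + 5*z^2 - 2*z*k - z" by (rule
      numeral_mult_cancelD)
  have "64 * (s*z^2 * (- (4*x) + s^2 - 2*s + 4*z - 4*k + 1)) - (16*x^3*z + 80*x^3 + 32*x^2*s^2 + 16*x^2*s*k -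
      256*x^2*s - 16*x^2*z^2 - 240*x^2*z - 32*x^2*k - 128*x^2 + 96*x*s^2 + 32*x*s*z^2 + 32*x*s*k - 256*x*s +
      96*x*z*k + 240*x*z - 480*x*k + 176*x - 32*s*z^2 + 16*s*k + 80*z^2 - 32*z*k - 16*z) =
    (16*x*z + 16*x - 88*s*z + 182*z - 132*k) * (- (x^2) - 3*x*s + 2*x*z + 2*x + s^3 - 3*s^2 + 3*s*z - 4*s*k + 3*s -
        z^2 - 2*z + 3*k - 1) + (- (8*x*s) - 82*x + 44*s^2 + 8*s*z - 91*s + 158*z - 216*k + 66) * (4*x*s - 3*x*z +
        2*x*k - 3*x + 2*s^2*z - 6*s*z + 3*s*k + 3*z^2 - 2*z*k + 3*z - 2*k) + (- (176*x) + 48*s^2 - 120*s + 144*z -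
        192*k + 176) * (- (4*x*s) + 3*x + s*z^2 - 3*z^2 + 3*z*k - k^2) + (64*x - 48*k + 35) * (- (2*x^2) - x*s*z -
        3*x*s + 2*x*z + 2*x - s^2*k + s*z^2 + s*z - 6*z*k + 4*k^2) + (16*x + 140) * (4*x^2 + 6*x*s - x*z^2 - x*z -
        2*x*k - 4*x - s*z*k + z^3 + z^2) + (176) * (- (x^2) - x*s^2 - x*s*z + 4*x*k - z^2*k)" by algebra
  then have "16 * (4 * (s*z^2 * y)) = 16 * (x^3*z + 5*x^3 + 2*x^2*s^2 + x^2*s*k - 16*x^2*s - x^2*z^2 - 15*x^2*z -
      2*x^2*k - 8*x^2 + 6*x*s^2 + 2*x*s*z^2 + 2*x*s*k - 16*x*s + 6*x*z*k + 15*x*z - 30*x*k + 11*x - 2*s*z^2 + s*k +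
      5*z^2 - 2*z*k - z)" unfolding r1 r2 r3 r4 r5 r6 y0 by algebra
  then have t9: "4 * (s*z^2 * y) = x^3*z + 5*x^3 + 2*x^2*s^2 + x^2*s*k - 16*x^2*s - x^2*z^2 - 15*x^2*z - 2*x^2*k -
      8*x^2 + 6*x*s^2 + 2*x*s*z^2 + 2*x*s*k - 16*x*s + 6*x*z*k + 15*x*z - 30*x*k + 11*x - 2*s*z^2 + s*k + 5*z^2 -
      2*z*k - z" by (rule numeral_mult_cancelD)
  text \<open>Multiplication by y on the basis 1, s, z, s^2, k, sz, z^2, sk, zk, sz^2 is now known, and the claimed
    polynomial, the characteristic polynomial of this multiplication, is evaluated by Horner's scheme.\<close>
  define h0 where "h0 = (1::'a)"
  define h1 where "h1 = h0 * y + (18*x)"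
  define h2 where "h2 = h1 * y + (123*x^2)"
  define h3 where "h3 = h2 * y + (- (3*x^4) + 420*x^3 + 54*x^2)"
  define h4 where "h4 = h3 * y + (- (36*x^5) + 751*x^4 + 486*x^3)"
  define h5 where "h5 = h4 * y + (- (138*x^6) + 354*x^5 + 1053*x^4)"
  define h6 where "h6 = h5 * y + (3*x^8 - 228*x^7 - 213*x^6 + 162*x^5 + 729*x^4)"
  define h7 where "h7 = h6 * y + (18*x^9 - 215*x^8 + 2*x^7 - 360*x^6)"
  define h8 where "h8 = h7 * y + (15*x^10 + 24*x^9 - 71*x^8 - 54*x^7)"
  define h9 where "h9 = h8 * y + (- (x^12) + 24*x^11 - 8*x^10 + 54*x^9 - x^8)"
  define h10 where "h10 = h9 * y + (4*x^12 + 4*x^11 + x^10)"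
  have g0: "h0 = 1" by (simp add: h0_def)
  \<comment> \<open>Each value of the scheme is rewritten on the basis before the next
    multiplication by \<open>y\<close>, so the table suffices throughout.\<close>
  have g1: "h1 = 14*x + s^2 - 2*s + 4*z - 4*k + 1"
  proof -
    have "(h1) = 1 * (h0) * y + 1 * (18*x)" unfolding h1_def by algebra
    also have "\<dots> = (1) * y + 1 * (18*x)" unfolding g0 by algebra
    also have "\<dots> = (14*x + s^2 - 2*s + 4*z - 4*k + 1)" unfolding y0 by algebra
    finally show ?thesis by simp
  qed
  have g2: "2 * h2 = 2*x^2*s + 148*x^2 + 26*x*s^2 + 4*x*s*z - 46*x*s + 83*x*z - 90*x*k + 23*x - 6*s*z^2 + 3*s*k +
      15*z^2 - 6*z*k - 3*z"
  proof -
    have "(2 * h2) = 2 * (h1) * y + 2 * (123*x^2)" unfolding h2_def by algebra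
    also have "\<dots> = (28*x + 2) * y + (- (4)) * (s * y) + (4) * (2 * (z * y)) + (1) * (2 * (s^2 * y)) + (- (8))
        * (k * y) + 2 * (123*x^2)" unfolding g1 by algebra
    also have "\<dots> = (2*x^2*s + 148*x^2 + 26*x*s^2 + 4*x*s*z - 46*x*s + 83*x*z - 90*x*k + 23*x - 6*s*z^2 +
        3*s*k + 15*z^2 - 6*z*k - 3*z)" unfolding t1 t2 t3 t4 unfolding y0 by algebra
    finally show ?thesis by simp
  qed
  have g3: "4 * h3 = - (8*x^4) + 48*x^3*s - 5*x^3*z + 775*x^3 + 238*x^2*s^2 + 72*x^2*s*z - 5*x^2*s*k - 308*x^2*s +
      x^2*z^2 + 632*x^2*z - 678*x^2*k + 313*x^2 - 126*x*s*z^2 - 36*x*s*z + 63*x*s*k + 279*x*z^2 - 126*x*z*k + 9*x*z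
      - 36*x*k"
  proof -
    have "2 * (4 * h3) = 4 * (2 * h2) * y + 8 * (- (3*x^4) + 420*x^3 + 54*x^2)" unfolding h3_def by algebra
    also have "\<dots> = (592*x^2 + 92*x) * y + (8*x^2 - 184*x) * (s * y) + (166*x - 6) * (2 * (z * y)) + (52*x) *
        (2 * (s^2 * y)) + (- (360*x)) * (k * y) + (4*x) * (4 * (s*z * y)) + (15) * (4 * (z^2 * y)) + (3) * (4 *
        (s*k * y)) + (- (6)) * (4 * (z*k * y)) + (- (6)) * (4 * (s*z^2 * y)) + 8 * (- (3*x^4) + 420*x^3 + 54*x^2)"
        unfolding g2 by algebra
    also have "\<dots> = 2 * (- (8*x^4) + 48*x^3*s - 5*x^3*z + 775*x^3 + 238*x^2*s^2 + 72*x^2*s*z - 5*x^2*s*k -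
        308*x^2*s + x^2*z^2 + 632*x^2*z - 678*x^2*k + 313*x^2 - 126*x*s*z^2 - 36*x*s*z + 63*x*s*k + 279*x*z^2 -
        126*x*z*k + 9*x*z - 36*x*k)" unfolding t1 t2 t3 t4 t5 t6 t7 t8 t9 unfolding y0 by algebra
    finally show ?thesis by (rule numeral_mult_cancelD)
  qed
  have g4: "h4 = - (16*x^5) - 2*x^4*s^2 + 54*x^4*s - 23*x^4*z + 8*x^4*k + 190*x^4 + 124*x^3*s^2 + 46*x^3*s*z -
      9*x^3*s*k - 93*x^3*s + 3*x^3*z^2 + 6*x^3*z*k + 334*x^3*z - 315*x^3*k + 318*x^3 + 27*x^2*s^2 - 104*x^2*s*z^2 -
      54*x^2*s*z + 25*x^2*s*k - 54*x^2*s + 233*x^2*z^2 - 158*x^2*z*k + 191*x^2*z - 162*x^2*k + 27*x^2"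
  proof -
    have "16 * (h4) = 4 * (4 * h3) * y + 16 * (- (36*x^5) + 751*x^4 + 486*x^3)" unfolding h4_def by algebra
    also have "\<dots> = (- (32*x^4) + 3100*x^3 + 1252*x^2) * y + (192*x^3 - 1232*x^2) * (s * y) + (- (10*x^3) +
        1264*x^2 + 18*x) * (2 * (z * y)) + (476*x^2) * (2 * (s^2 * y)) + (- (2712*x^2) - 144*x) * (k * y) + (72*x^2
        - 36*x) * (4 * (s*z * y)) + (x^2 + 279*x) * (4 * (z^2 * y)) + (- (5*x^2) + 63*x) * (4 * (s*k * y)) + (-
        (126*x)) * (4 * (z*k * y)) + (- (126*x)) * (4 * (s*z^2 * y)) + 16 * (- (36*x^5) + 751*x^4 + 486*x^3)"
        unfolding g3 by algebra
    also have "\<dots> = 16 * (- (16*x^5) - 2*x^4*s^2 + 54*x^4*s - 23*x^4*z + 8*x^4*k + 190*x^4 + 124*x^3*s^2 +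
        46*x^3*s*z - 9*x^3*s*k - 93*x^3*s + 3*x^3*z^2 + 6*x^3*z*k + 334*x^3*z - 315*x^3*k + 318*x^3 + 27*x^2*s^2 -
        104*x^2*s*z^2 - 54*x^2*s*z + 25*x^2*s*k - 54*x^2*s + 233*x^2*z^2 - 158*x^2*z*k + 191*x^2*z - 162*x^2*k +
        27*x^2)" unfolding t1 t2 t3 t4 t5 t6 t7 t8 t9 unfolding y0 by algebra
    finally show ?thesis by (rule numeral_mult_cancelD)
  qed
  have g5: "2 * h5 = - (4*x^6*s) - 76*x^6 - 28*x^5*s^2 - 8*x^5*s*z + 264*x^5*s - 196*x^5*z + 96*x^5*k - 330*x^5 +
      182*x^4*s^2 + 214*x^4*s*z - 24*x^4*s*k - 6*x^4*s + 32*x^4*z^2 + 84*x^4*z*k + 204*x^4*z - 236*x^4*k + 958*x^4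
      + 54*x^3*s^2 - 234*x^3*s*z^2 - 468*x^3*s*z + 36*x^3*s*k + 54*x^3*s + 414*x^3*z^2 - 396*x^3*z*k + 1089*x^3*z -
      738*x^3*k - 27*x^3 - 162*x^2*s*z^2 + 81*x^2*s*k + 405*x^2*z^2 - 162*x^2*z*k - 81*x^2*z"
  proof -
    have "2 * (2 * h5) = 4 * (h4) * y + 4 * (- (138*x^6) + 354*x^5 + 1053*x^4)" unfolding h5_def by algebra
    also have "\<dots> = (- (64*x^5) + 760*x^4 + 1272*x^3 + 108*x^2) * y + (216*x^4 - 372*x^3 - 216*x^2) * (s * y)
        + (- (46*x^4) + 668*x^3 + 382*x^2) * (2 * (z * y)) + (- (4*x^4) + 248*x^3 + 54*x^2) * (2 * (s^2 * y)) +
        (32*x^4 - 1260*x^3 - 648*x^2) * (k * y) + (46*x^3 - 54*x^2) * (4 * (s*z * y)) + (3*x^3 + 233*x^2) * (4 *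
        (z^2 * y)) + (- (9*x^3) + 25*x^2) * (4 * (s*k * y)) + (6*x^3 - 158*x^2) * (4 * (z*k * y)) + (- (104*x^2)) *
        (4 * (s*z^2 * y)) + 4 * (- (138*x^6) + 354*x^5 + 1053*x^4)" unfolding g4 by algebra
    also have "\<dots> = 2 * (- (4*x^6*s) - 76*x^6 - 28*x^5*s^2 - 8*x^5*s*z + 264*x^5*s - 196*x^5*z + 96*x^5*k -
        330*x^5 + 182*x^4*s^2 + 214*x^4*s*z - 24*x^4*s*k - 6*x^4*s + 32*x^4*z^2 + 84*x^4*z*k + 204*x^4*z -
        236*x^4*k + 958*x^4 + 54*x^3*s^2 - 234*x^3*s*z^2 - 468*x^3*s*z + 36*x^3*s*k + 54*x^3*s + 414*x^3*z^2 -
        396*x^3*z*k + 1089*x^3*z - 738*x^3*k - 27*x^3 - 162*x^2*s*z^2 + 81*x^2*s*k + 405*x^2*z^2 - 162*x^2*z*k -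
        81*x^2*z)" unfolding t1 t2 t3 t4 t5 t6 t7 t8 t9 unfolding y0 by algebra
    finally show ?thesis by (rule numeral_mult_cancelD)
  qed
  have g6: "4 * h6 = 4*x^8 - 48*x^7*s + 4*x^7*z - 164*x^7 - 96*x^6*s^2 - 72*x^6*s*z + 4*x^6*s*k + 572*x^6*s +
      4*x^6*z^2 - 382*x^6*z + 256*x^6*k - 1254*x^6 - 12*x^5*s^2 - 24*x^5*s*z^2 + 516*x^5*s*z - 54*x^5*s*k +
      80*x^5*s + 114*x^5*z^2 + 152*x^5*z*k - 1073*x^5*z + 608*x^5*k - 35*x^5 + 162*x^4*s^2 + 96*x^4*s*z^2 -
      48*x^4*s*z - 27*x^4*s*k + 324*x^4*s - 93*x^4*z^2 + 84*x^4*z*k + 582*x^4*z - 426*x^4*k + 1701*x^4 -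
      486*x^3*s*z^2 - 972*x^3*s*z + 243*x^3*s*k + 243*x^3*z^2 - 486*x^3*z*k + 1701*x^3*z - 972*x^3*k"
  proof -
    have "2 * (4 * h6) = 4 * (2 * h5) * y + 8 * (3*x^8 - 228*x^7 - 213*x^6 + 162*x^5 + 729*x^4)" unfolding h6_def by algebra
    also have "\<dots> = (- (304*x^6) - 1320*x^5 + 3832*x^4 - 108*x^3) * y + (- (16*x^6) + 1056*x^5 - 24*x^4 +
        216*x^3) * (s * y) + (- (392*x^5) + 408*x^4 + 2178*x^3 - 162*x^2) * (2 * (z * y)) + (- (56*x^5) + 364*x^4 +
        108*x^3) * (2 * (s^2 * y)) + (384*x^5 - 944*x^4 - 2952*x^3) * (k * y) + (- (8*x^5) + 214*x^4 - 468*x^3) *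
        (4 * (s*z * y)) + (32*x^4 + 414*x^3 + 405*x^2) * (4 * (z^2 * y)) + (- (24*x^4) + 36*x^3 + 81*x^2) * (4 *
        (s*k * y)) + (84*x^4 - 396*x^3 - 162*x^2) * (4 * (z*k * y)) + (- (234*x^3) - 162*x^2) * (4 * (s*z^2 * y)) +
        8 * (3*x^8 - 228*x^7 - 213*x^6 + 162*x^5 + 729*x^4)" unfolding g5 by algebra
    also have "\<dots> = 2 * (4*x^8 - 48*x^7*s + 4*x^7*z - 164*x^7 - 96*x^6*s^2 - 72*x^6*s*z + 4*x^6*s*k +
        572*x^6*s + 4*x^6*z^2 - 382*x^6*z + 256*x^6*k - 1254*x^6 - 12*x^5*s^2 - 24*x^5*s*z^2 + 516*x^5*s*z -
        54*x^5*s*k + 80*x^5*s + 114*x^5*z^2 + 152*x^5*z*k - 1073*x^5*z + 608*x^5*k - 35*x^5 + 162*x^4*s^2 +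
        96*x^4*s*z^2 - 48*x^4*s*z - 27*x^4*s*k + 324*x^4*s - 93*x^4*z^2 + 84*x^4*z*k + 582*x^4*z - 426*x^4*k +
        1701*x^4 - 486*x^3*s*z^2 - 972*x^3*s*z + 243*x^3*s*k + 243*x^3*z^2 - 486*x^3*z*k + 1701*x^3*z - 972*x^3*k)"
        unfolding t1 t2 t3 t4 t5 t6 t7 t8 t9 unfolding y0 by algebra
    finally show ?thesis by (rule numeral_mult_cancelD)
  qed
  have g7: "4 * h7 = 8*x^9 + 4*x^8*s^2 - 64*x^8*s + 40*x^8*z - 16*x^8*k - 28*x^8 - 88*x^7*s^2 - 40*x^7*s*z +
      92*x^7*s + 24*x^7*z^2 - 24*x^7*z*k - 143*x^7*z + 156*x^7*k + 21*x^7 + 38*x^6*s^2 + 32*x^6*s*z^2 + 68*x^6*s*z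
      + x^6*s*k - 28*x^6*s - 269*x^6*z^2 + 128*x^6*z*k - 187*x^6*z + 86*x^6*k - 1108*x^6 - 18*x^5*s^2 +
      154*x^5*s*z^2 + 584*x^5*s*z - 158*x^5*s*k + 252*x^5*s + 100*x^5*z^2 + 154*x^5*z*k - 1019*x^5*z + 566*x^5*k -
      207*x^5 - 54*x^4*s*z^2 + 27*x^4*s*k + 135*x^4*z^2 - 54*x^4*z*k - 27*x^4*z"
  proof -
    have "4 * (4 * h7) = 4 * (4 * h6) * y + 16 * (18*x^9 - 215*x^8 + 2*x^7 - 360*x^6)" unfolding h7_def by algebra
    also have "\<dots> = (16*x^8 - 656*x^7 - 5016*x^6 - 140*x^5 + 6804*x^4) * y + (- (192*x^7) + 2288*x^6 + 320*x^5
        + 1296*x^4) * (s * y) + (8*x^7 - 764*x^6 - 2146*x^5 + 1164*x^4 + 3402*x^3) * (2 * (z * y)) + (- (192*x^6) -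
        24*x^5 + 324*x^4) * (2 * (s^2 * y)) + (1024*x^6 + 2432*x^5 - 1704*x^4 - 3888*x^3) * (k * y) + (- (72*x^6) +
        516*x^5 - 48*x^4 - 972*x^3) * (4 * (s*z * y)) + (4*x^6 + 114*x^5 - 93*x^4 + 243*x^3) * (4 * (z^2 * y)) +
        (4*x^6 - 54*x^5 - 27*x^4 + 243*x^3) * (4 * (s*k * y)) + (152*x^5 + 84*x^4 - 486*x^3) * (4 * (z*k * y)) + (-
        (24*x^5) + 96*x^4 - 486*x^3) * (4 * (s*z^2 * y)) + 16 * (18*x^9 - 215*x^8 + 2*x^7 - 360*x^6)" unfolding g6
        by algebra
    also have "\<dots> = 4 * (8*x^9 + 4*x^8*s^2 - 64*x^8*s + 40*x^8*z - 16*x^8*k - 28*x^8 - 88*x^7*s^2 - 40*x^7*s*z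
        + 92*x^7*s + 24*x^7*z^2 - 24*x^7*z*k - 143*x^7*z + 156*x^7*k + 21*x^7 + 38*x^6*s^2 + 32*x^6*s*z^2 +
        68*x^6*s*z + x^6*s*k - 28*x^6*s - 269*x^6*z^2 + 128*x^6*z*k - 187*x^6*z + 86*x^6*k - 1108*x^6 - 18*x^5*s^2
        + 154*x^5*s*z^2 + 584*x^5*s*z - 158*x^5*s*k + 252*x^5*s + 100*x^5*z^2 + 154*x^5*z*k - 1019*x^5*z +
        566*x^5*k - 207*x^5 - 54*x^4*s*z^2 + 27*x^4*s*k + 135*x^4*z^2 - 54*x^4*z*k - 27*x^4*z)" unfolding t1 t2 t3
        t4 t5 t6 t7 t8 t9 unfolding y0 by algebra
    finally show ?thesis by (rule numeral_mult_cancelD)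
  qed
  have g8: "2 * h8 = 2*x^10*s + 2*x^9*s^2 + 4*x^9*s*z - 50*x^9*s + 20*x^9*z - 6*x^9*k + 114*x^9 - 6*x^8*s^2 +
      6*x^8*s*z^2 - 34*x^8*s*z + 42*x^8*s - 26*x^8*z^2 - 6*x^8*z*k + 72*x^8*z - 42*x^8*k - 78*x^8 - 10*x^7*s^2 -
      12*x^7*s*z^2 + 14*x^7*s*z + 2*x^7*s*k - 74*x^7*s + 40*x^7*z^2 - 14*x^7*z*k - 49*x^7*z + 42*x^7*k - 11*x^7 +
      6*x^6*s^2 + 34*x^6*s*z^2 + 44*x^6*s*z - 25*x^6*s*k - 12*x^6*s - 51*x^6*z^2 + 36*x^6*z*k - 57*x^6*z + 38*x^6*k
      + 6*x^6"
  proof -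
    have "8 * (2 * h8) = 4 * (4 * h7) * y + 16 * (15*x^10 + 24*x^9 - 71*x^8 - 54*x^7)" unfolding h8_def by algebra
    also have "\<dots> = (32*x^9 - 112*x^8 + 84*x^7 - 4432*x^6 - 828*x^5) * y + (- (256*x^8) + 368*x^7 - 112*x^6 +
        1008*x^5) * (s * y) + (80*x^8 - 286*x^7 - 374*x^6 - 2038*x^5 - 54*x^4) * (2 * (z * y)) + (8*x^8 - 176*x^7 +
        76*x^6 - 36*x^5) * (2 * (s^2 * y)) + (- (64*x^8) + 624*x^7 + 344*x^6 + 2264*x^5) * (k * y) + (- (40*x^7) +
        68*x^6 + 584*x^5) * (4 * (s*z * y)) + (24*x^7 - 269*x^6 + 100*x^5 + 135*x^4) * (4 * (z^2 * y)) + (x^6 -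
        158*x^5 + 27*x^4) * (4 * (s*k * y)) + (- (24*x^7) + 128*x^6 + 154*x^5 - 54*x^4) * (4 * (z*k * y)) + (32*x^6
        + 154*x^5 - 54*x^4) * (4 * (s*z^2 * y)) + 16 * (15*x^10 + 24*x^9 - 71*x^8 - 54*x^7)" unfolding g7 by
        algebra
    also have "\<dots> = 8 * (2*x^10*s + 2*x^9*s^2 + 4*x^9*s*z - 50*x^9*s + 20*x^9*z - 6*x^9*k + 114*x^9 -
        6*x^8*s^2 + 6*x^8*s*z^2 - 34*x^8*s*z + 42*x^8*s - 26*x^8*z^2 - 6*x^8*z*k + 72*x^8*z - 42*x^8*k - 78*x^8 -
        10*x^7*s^2 - 12*x^7*s*z^2 + 14*x^7*s*z + 2*x^7*s*k - 74*x^7*s + 40*x^7*z^2 - 14*x^7*z*k - 49*x^7*z +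
        42*x^7*k - 11*x^7 + 6*x^6*s^2 + 34*x^6*s*z^2 + 44*x^6*s*z - 25*x^6*s*k - 12*x^6*s - 51*x^6*z^2 + 36*x^6*z*k
        - 57*x^6*z + 38*x^6*k + 6*x^6)" unfolding t1 t2 t3 t4 t5 t6 t7 t8 t9 unfolding y0 by algebra
    finally show ?thesis by (rule numeral_mult_cancelD)
  qed
  have g9: "4 * h9 = x^11*z + 13*x^11 + 2*x^10*s^2 + x^10*s*k - 20*x^10*s - 5*x^10*z^2 + 14*x^10*z - 10*x^10*k -
      19*x^10 + 6*x^9*s*z^2 + 8*x^9*s*z - 9*x^9*s*k - 8*x^9*s + 15*x^9*z^2 - 2*x^9*z*k + 5*x^9*z + 4*x^9*k +
      176*x^9 - 12*x^8*s^2 - 20*x^8*s*z^2 - 88*x^8*s*z + 24*x^8*s*k + 24*x^8*s - 20*x^8*z^2 - 24*x^8*z*k +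
      140*x^8*z - 76*x^8*k - 12*x^8"
  proof -
    have "2 * (4 * h9) = 4 * (2 * h8) * y + 8 * (- (x^12) + 24*x^11 - 8*x^10 + 54*x^9 - x^8)" unfolding h9_def by algebra
    also have "\<dots> = (456*x^9 - 312*x^8 - 44*x^7 + 24*x^6) * y + (8*x^10 - 200*x^9 + 168*x^8 - 296*x^7 -
        48*x^6) * (s * y) + (40*x^9 + 144*x^8 - 98*x^7 - 114*x^6) * (2 * (z * y)) + (4*x^9 - 12*x^8 - 20*x^7 +
        12*x^6) * (2 * (s^2 * y)) + (- (24*x^9) - 168*x^8 + 168*x^7 + 152*x^6) * (k * y) + (4*x^9 - 34*x^8 + 14*x^7
        + 44*x^6) * (4 * (s*z * y)) + (- (26*x^8) + 40*x^7 - 51*x^6) * (4 * (z^2 * y)) + (2*x^7 - 25*x^6) * (4 *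
        (s*k * y)) + (- (6*x^8) - 14*x^7 + 36*x^6) * (4 * (z*k * y)) + (6*x^8 - 12*x^7 + 34*x^6) * (4 * (s*z^2 *
        y)) + 8 * (- (x^12) + 24*x^11 - 8*x^10 + 54*x^9 - x^8)" unfolding g8 by algebra
    also have "\<dots> = 2 * (x^11*z + 13*x^11 + 2*x^10*s^2 + x^10*s*k - 20*x^10*s - 5*x^10*z^2 + 14*x^10*z -
        10*x^10*k - 19*x^10 + 6*x^9*s*z^2 + 8*x^9*s*z - 9*x^9*s*k - 8*x^9*s + 15*x^9*z^2 - 2*x^9*z*k + 5*x^9*z +
        4*x^9*k + 176*x^9 - 12*x^8*s^2 - 20*x^8*s*z^2 - 88*x^8*s*z + 24*x^8*s*k + 24*x^8*s - 20*x^8*z^2 -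
        24*x^8*z*k + 140*x^8*z - 76*x^8*k - 12*x^8)" unfolding t1 t2 t3 t4 t5 t6 t7 t8 t9 unfolding y0 by algebra
    finally show ?thesis by (rule numeral_mult_cancelD)
  qed
  have g10: "h10 = 0"
  proof -
    have "16 * (h10) = 4 * (4 * h9) * y + 16 * (4*x^12 + 4*x^11 + x^10)" unfolding h10_def by algebra
    also have "\<dots> = (52*x^11 - 76*x^10 + 704*x^9 - 48*x^8) * y + (- (80*x^10) - 32*x^9 + 96*x^8) * (s * y) +
        (2*x^11 + 28*x^10 + 10*x^9 + 280*x^8) * (2 * (z * y)) + (4*x^10 - 24*x^8) * (2 * (s^2 * y)) + (- (40*x^10)
        + 16*x^9 - 304*x^8) * (k * y) + (8*x^9 - 88*x^8) * (4 * (s*z * y)) + (- (5*x^10) + 15*x^9 - 20*x^8) * (4 *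
        (z^2 * y)) + (x^10 - 9*x^9 + 24*x^8) * (4 * (s*k * y)) + (- (2*x^9) - 24*x^8) * (4 * (z*k * y)) + (6*x^9 -
        20*x^8) * (4 * (s*z^2 * y)) + 16 * (4*x^12 + 4*x^11 + x^10)" unfolding g9 by algebra
    also have "\<dots> = 16 * (0)" unfolding t1 t2 t3 t4 t5 t6 t7 t8 t9 unfolding y0 by algebra
    finally show ?thesis by (rule numeral_mult_cancelD)
  qed
  show ?thesis using g10 unfolding h10_def h9_def h8_def h7_def h6_def h5_def h4_def h3_def h2_def h1_def h0_def by algebra
qed

section \<open>The polynomial equation\<close>

lemma fps_ones_mult: "Abs_fps (\<lambda>_. 1) * (1 - fps_X) = (1 :: 'a :: comm_ring_1 fps)"
  by (rule fps_ext) (simp add: right_diff_distrib fps_mult_fps_X_commute [symmetric] fps_X_mult_nth flip: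
      mult.commute [of fps_X])

text \<open>A sequence of series in y becomes one series in y over the series in x. The outer
  variable marks the height, so coefficient 0 is the generating function of the forests; x itself is
  \<open>fps_const fps_X\<close>.\<close>

definition fps_swap :: "(nat \<Rightarrow> 'a fps) \<Rightarrow> 'a::comm_ring_1 fps fps" where
  "fps_swap g = Abs_fps (\<lambda>k. Abs_fps (\<lambda>n. g n $ k))"

lemma fps_swap_nth [simp]: "fps_swap g $ k $ n = g n $ k"
  by (simp add: fps_swap_def)

lemma fps_swap_add: "fps_swap (\<lambda>n. f n + g n) = fps_swap f + fps_swap g"
  by (intro fps_ext) simp

lemma fps_swap_shift: "fps_swap (\<lambda>n. fps_shift i (f n)) = fps_shift i (fps_swap f)"
  by (intro fps_ext) simp

lemma fps_swap_const: "fps_swap (\<lambda>n. fps_const (f n $ 0)) = fps_const (fps_swap f $ 0)"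
  by (intro fps_ext) simp

lemma fps_swap_ones_mult: "fps_swap (\<lambda>n. Abs_fps (\<lambda>_. 1) * f n) = Abs_fps (\<lambda>_. 1) * fps_swap f"
  by (intro fps_ext) (simp add: fps_mult_nth fps_sum_nth)

lemma fps_swap_shrub_step: "fps_swap (\<lambda>n. shrub_step (f n)) = shrub_step (fps_swap f)"
  unfolding shrub_step_def Let_def
  by (simp only: fps_swap_add fps_swap_ones_mult fps_swap_shift fps_swap_const)

lemma fps_swap_funpow:
  defines "F \<equiv> fps_swap (\<lambda>n. (shrub_step ^^ n) (1 :: 'a :: idom fps))"
  shows "(fps_X ^ 3 * (fps_X - 1) ^ 3 + fps_const fps_X * (1 - fps_X + fps_X ^ 3)) * F =
    (fps_X - 1) * (fps_X ^ 3 * (1 - fps_X)^2 - fps_const fps_X * (fps_const (F $ 0) * (1 - fps_X ^ 3 * (1 - fps_X))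
      + fps_const (F $ 1) * (fps_X * (1 - fps_X) * (1 + fps_X - fps_X^2))
      + fps_const (F $ 2) * (fps_X^2 * (1 - fps_X)^2)))"
proof (rule kernel_identity [OF fps_ones_mult])
  have "F = 1 + fps_const fps_X * fps_swap (\<lambda>n. shrub_step ((shrub_step ^^ n) 1))"
  proof (intro fps_ext)
    fix k n
    show "F $ k $ n = (1 + fps_const fps_X * fps_swap (\<lambda>n. shrub_step ((shrub_step ^^ n) 1))) $ k $ n"
      by (cases n) (auto simp: F_def)
  qed
  then show "F = 1 + fps_const fps_X * (Abs_fps (\<lambda>_. 1) * (Abs_fps (\<lambda>_. 1) * (Abs_fps (\<lambda>_.
      1) * F + fps_shift 1 F)
      + fps_shift 1 (fps_shift 1 F)) + fps_shift 1 (Abs_fps (\<lambda>_. 1) * (fps_const (F $ 0) + fps_shift 1 F)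
      + fps_shift 1 (fps_shift 1 F)))"
    unfolding fps_swap_shrub_step F_def [symmetric] unfolding shrub_step_def Let_def .
qed

text \<open>Past degree 6 in y the right side of the kernel equation is zero, so the boundary
  unknowns disappear. The growth argument sums this homogeneous form over n; the second claim is its
  initial value.\<close>

lemma shrub_step_recurrence:
  fixes n k :: nat
  defines "c \<equiv> \<lambda>n k. (shrub_step ^^ n) (1 :: 'a :: idom fps) $ k"
  assumes "k \<ge> 1"
  shows "c (Suc n) k - 3 * c (Suc n) (k + 1) + 3 * c (Suc n) (k + 2) - c (Suc n) (k + 3)
    + (c n (k + 6) - c n (k + 5) + c n (k + 3)) = 0"
    and "c 0 k = 0"
proof -
  define F :: "'a fps fps" where "F = fps_swap (\<lambda>n. (shrub_step ^^ n) 1)"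
  define x :: "'a fps fps" where "x = fps_const fps_X"
  let ?X = "fps_X :: 'a fps fps"
  have eq: "(?X ^ 3 * (?X - 1) ^ 3 + x * (1 - ?X + ?X ^ 3)) * F =
      ?X ^ 6 * F - 3 * (?X ^ 5 * F) + 3 * (?X ^ 4 * F) - ?X ^ 3 * F + x * (F - ?X * F + ?X ^ 3 * F)"
    by algebra
  have rhs: "((?X - 1) * (?X ^ 3 * (1 - ?X)^2 - x * (fps_const f0 * (1 - ?X ^ 3 * (1 - ?X))
      + fps_const f1 * (?X * (1 - ?X) * (1 + ?X - ?X^2)) + fps_const f2 * (?X^2 * (1 - ?X)^2)))) $ m = 0"
    if "m > 6" for m f0 f1 f2
  proof -
    have "(?X - 1) * (?X ^ 3 * (1 - ?X)^2 - x * (fps_const f0 * (1 - ?X ^ 3 * (1 - ?X))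
      + fps_const f1 * (?X * (1 - ?X) * (1 + ?X - ?X^2)) + fps_const f2 * (?X^2 * (1 - ?X)^2))) =
      ?X^6 - 3 * ?X^5 + 3 * ?X^4 - ?X^3 - x * (fps_const f0 * (?X - 1 + ?X^3 - 2 * ?X^4 + ?X^5)
       + fps_const f1 * (?X^2 - ?X - 3 * ?X^4 + 2 * ?X^3 + ?X^5) + fps_const f2 * (?X^5 - 3 * ?X^4 + 3 * ?X^3 - ?X^2))"
      by algebra
    then show ?thesis
      unfolding x_def using that by (simp only:) (simp add: fps_X_power_nth numeral_fps_const)
  qed
  have "(?X ^ 6 * F - 3 * (?X ^ 5 * F) + 3 * (?X ^ 4 * F) - ?X ^ 3 * F + x * (F - ?X * F + ?X ^ 3 * F)) $ (k + 6) = 0"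
    unfolding eq [symmetric] fps_swap_funpow [where 'a='a, folded F_def, folded x_def]
    by (rule rhs) (use assms in simp)
  then have "F $ k - 3 * F $ (k + 1) + 3 * F $ (k + 2) - F $ (k + 3)
      + fps_X * (F $ (k + 6) - F $ (k + 5) + F $ (k + 3)) = 0"
    by (simp add: x_def fps_X_power_mult_nth numeral_fps_const fps_X_mult_nth add.commute)
  from arg_cong [OF this, of "\<lambda>f. f $ Suc n"]
  show "c (Suc n) k - 3 * c (Suc n) (k + 1) + 3 * c (Suc n) (k + 2) - c (Suc n) (k + 3)
      + (c n (k + 6) - c n (k + 5) + c n (k + 3)) = 0"
    by (simp add: F_def c_def numeral_fps_const fps_X_mult_nth del: funpow.simps)
  show "c 0 k = 0" using assms by (simp add: c_def)
qed

lemma shrub_polynomial: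
  fixes H :: "real fps"
  assumes H: "\<And>n. H $ n = (shrub_step ^^ n) (1 :: real fps) $ 0"
  shows "(let x = (fps_X :: real fps) in
           (4 * x^2 + 4 * x + 1)
         - (x^4 - 24 * x^3 + 8 * x^2 - 54 * x + 1) * H^2
         + (15 * x^4 + 24 * x^3 - 71 * x^2 - 54 * x) * H^4
         + (18 * x^5 - 215 * x^4 + 2 * x^3 - 360 * x^2) * H^6
         + (3 * x^6 - 228 * x^5 - 213 * x^4 + 162 * x^3 + 729 * x^2) * H^8
         - (138 * x^6 - 354 * x^5 - 1053 * x^4) * H^10
         - (36 * x^7 - 751 * x^6 - 486 * x^5) * H^12
         - (3 * x^8 - 420 * x^7 - 54 * x^6) * H^14
         + 123 * x^8 * H^16
         + 18 * x^9 * H^18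
         + x^10 * H^20 = 0)"
proof -
  define x :: "real fps" where "x = fps_X"
  define F :: "real fps fps" where "F = fps_swap (\<lambda>n. (shrub_step ^^ n) 1)"
  have F0: "F $ 0 = H" by (rule fps_ext) (simp add: F_def H)
  obtain a0 a1 a2 b0 b1 b2 :: "real fps" where f: "a0 * b0 = fps_X" "a0 * b1 + a1 * b0 = - fps_X"
    "a0 * b2 + a1 * b1 + a2 * b0 = 0" "a0 + b0 + a1 * b2 + a2 * b1 = fps_X - 1"
    "a1 + b1 + a2 * b2 = 3" "a2 + b2 = - 3" and z: "a0 $ 0 = 0" "a1 $ 0 = 0" "a2 $ 0 = 0"
    by (rule kernel_factorization)
  have "x * H = (b1 - a1) + (b2 - a2)"
    using kernel_solution [OF fps_swap_funpow f z] unfolding F_def [symmetric] F0 x_def .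
  then have "(x * H)^2 = (b1 - a1 + (b2 - a2))^2" by simp
  \<comment> \<open>With y = (x H)^2 the eliminated polynomial has a factor x^10, which is cancelled
    below.\<close>
  from shrub_elimination [OF f this, folded x_def]
  have "x ^ 10 * ((4 * x^2 + 4 * x + 1)
         - (x^4 - 24 * x^3 + 8 * x^2 - 54 * x + 1) * H^2
         + (15 * x^4 + 24 * x^3 - 71 * x^2 - 54 * x) * H^4
         + (18 * x^5 - 215 * x^4 + 2 * x^3 - 360 * x^2) * H^6
         + (3 * x^6 - 228 * x^5 - 213 * x^4 + 162 * x^3 + 729 * x^2) * H^8
         - (138 * x^6 - 354 * x^5 - 1053 * x^4) * H^10
         - (36 * x^7 - 751 * x^6 - 486 * x^5) * H^12
         - (3 * x^8 - 420 * x^7 - 54 * x^6) * H^14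
         + 123 * x^8 * H^16
         + 18 * x^9 * H^18
         + x^10 * H^20) = 0"
    by algebra
  moreover have "x ^ 10 \<noteq> 0" by (simp add: x_def)
  ultimately show ?thesis
    unfolding Let_def x_def by (metis mult_eq_0_iff)
qed

section \<open>Positive solutions of linear recurrences\<close>

text \<open>Stated over the complex numbers because the multiples are assembled from linear factors
  there.\<close>

definition nonneg_coeffs :: "complex poly \<Rightarrow> bool" where
  "nonneg_coeffs M \<longleftrightarrow> (\<forall>i. \<exists>r\<ge>0. coeff M i = complex_of_real r)"

lemma nonneg_coeffs_add: "nonneg_coeffs M \<Longrightarrow> nonneg_coeffs N \<Longrightarrow> nonneg_coeffs (M + N)"
  unfolding nonneg_coeffs_def coeff_add by (metis add_nonneg_nonneg of_real_add)

lemma nonneg_coeffs_mult: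
  assumes "nonneg_coeffs M" "nonneg_coeffs N"
  shows "nonneg_coeffs (M * N)"
proof -
  obtain m n where m: "\<And>i. m i \<ge> 0" "\<And>i. coeff M i = complex_of_real (m i)"
    and n: "\<And>i. n i \<ge> 0" "\<And>i. coeff N i = complex_of_real (n i)"
    using assms unfolding nonneg_coeffs_def by metis
  have "coeff (M * N) i = complex_of_real (\<Sum>j\<le>i. m j * n (i - j))" for i
    by (simp add: coeff_mult m n)
  moreover have "(\<Sum>j\<le>i. m j * n (i - j)) \<ge> 0" for i
    by (intro sum_nonneg) (simp add: m n)
  ultimately show ?thesis unfolding nonneg_coeffs_def by blast
qed

lemma nonneg_coeffs_monom: "r \<ge> 0 \<Longrightarrow> nonneg_coeffs (monom (complex_of_real r) n)"
  unfolding nonneg_coeffs_def coeff_monom by (metis of_real_0 order_refl)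

text \<open>The multiples of the angle advance by at most pi, so the first one that is at least pi/2
  stays below 3 pi/2, where the cosine is not positive.\<close>

lemma power_Re_nonpos:
  fixes z :: complex
  assumes "\<And>y::real. y \<ge> 0 \<Longrightarrow> z \<noteq> of_real y"
  shows "\<exists>n\<ge>1. Re (z ^ n) \<le> 0"
proof -
  define \<theta> where "\<theta> = \<bar>Arg z\<bar>"
  have z: "z = rcis (cmod z) (Arg z)" by (simp add: rcis_cmod_Arg)
  have "Arg z \<noteq> 0"
  proof
    assume "Arg z = 0"
    then have "z = of_real (cmod z)" using z by (metis rcis_zero_arg)
    then show False using assms [of "cmod z"] by simp
  qed
  moreover have "z \<noteq> 0" using assms [of 0] by simp
  ultimately have \<theta>: "0 < \<theta>" "\<theta> \<le> pi"
    using Arg_bounded [of z] by (auto simp: \<theta>_def)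
  define n where "n = nat \<lceil>(pi / 2) / \<theta>\<rceil>"
  have pos: "0 < (pi / 2) / \<theta>" using \<theta> by simp
  then have n: "(pi / 2) / \<theta> \<le> real n" "real n < (pi / 2) / \<theta> + 1"
    unfolding n_def by linarith+
  then have "pi / 2 \<le> real n * \<theta>" "real n * \<theta> < pi / 2 + \<theta>"
    using \<theta> by (simp_all add: field_simps)
  then have "0 \<le> cos (real n * \<theta> - pi)"
    using \<theta> by (intro cos_ge_zero) auto
  then have "cos (real n * \<theta>) \<le> 0"
    by (simp add: cos_diff)
  moreover have "cos (real n * Arg z) = cos (real n * \<theta>)"
    unfolding \<theta>_def by (cases "Arg z \<ge> 0") auto
  moreover have "Re (z ^ n) = cmod z ^ n * cos (real n * Arg z)"
    by (subst z) (simp add: DeMoivre2 Re_rcis)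
  ultimately have "Re (z ^ n) \<le> 0"
    by (simp add: mult_nonneg_nonpos)
  moreover have "n \<ge> 1" using pos n(1) by (cases n) auto
  ultimately show ?thesis by blast
qed

text \<open>With n as in the previous lemma, the polynomial in y with roots z^n and its conjugate at y^n has nonnegative
  coefficients.\<close>

lemma linear_dvd_nonneg_coeffs:
  fixes z :: complex
  assumes "\<And>y::real. y \<ge> 0 \<Longrightarrow> z \<noteq> of_real y"
  shows "\<exists>M. nonneg_coeffs M \<and> coeff M 0 \<noteq> 0 \<and> [:- z, 1:] dvd M"
proof -
  obtain n where n: "n \<ge> 1" "Re (z ^ n) \<le> 0"
    using power_Re_nonpos [OF assms] by blast
  define M where "M = monom (complex_of_real 1) (2 * n) + monom (complex_of_real (- 2 * Re (z ^ n))) n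
    + monom (complex_of_real ((cmod (z ^ n))\<^sup>2)) 0"
  have "nonneg_coeffs M"
    unfolding M_def using n by (intro nonneg_coeffs_add nonneg_coeffs_monom) auto
  moreover have "coeff M 0 \<noteq> 0"
    using n assms [of 0] by (simp add: M_def)
  moreover have "poly M z = 0"
  proof -
    have "poly M z = (z ^ n)\<^sup>2 - 2 * complex_of_real (Re (z ^ n)) * z ^ n + complex_of_real ((cmod (z ^ n))\<^sup>2)"
      by (simp add: M_def poly_monom power_mult mult.commute)
    also have "complex_of_real ((cmod (z ^ n))\<^sup>2) = z ^ n * cnj (z ^ n)"
      using complex_norm_square [of "z ^ n"] by simp
    also have "2 * complex_of_real (Re (z ^ n)) = z ^ n + cnj (z ^ n)"
      using complex_add_cnj [of "z ^ n"] by simp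
    finally have "poly M z = (z ^ n)\<^sup>2 - (z ^ n + cnj (z ^ n)) * z ^ n + z ^ n * cnj (z ^ n)" .
    also have "\<dots> = 0"
      by (simp only: distrib_right power2_eq_square mult.commute [of "cnj (z ^ n)"]) simp
    finally show ?thesis .
  qed
  ultimately show ?thesis unfolding poly_eq_0_iff_dvd by blast
qed

text \<open>Linear factors are split off one at a time, and nonnegative coefficients survive
  multiplication. The nonzero constant term is carried along for the lower bound in
  \<open>positive_recurrence_root\<close>.\<close>

lemma dvd_nonneg_coeffs:
  fixes K :: "complex poly"
  assumes "\<And>y::real. y \<ge> 0 \<Longrightarrow> poly K (of_real y) \<noteq> 0"
  shows "\<exists>M. nonneg_coeffs M \<and> coeff M 0 \<noteq> 0 \<and> K dvd M"
  using assms
proof (induction "degree K" arbitrary: K)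
  case 0
  have "poly K 0 \<noteq> 0" using 0(2) [of 0] by simp
  then have "K \<noteq> 0" by auto
  with 0 have "K dvd 1" by (simp add: is_unit_iff_degree)
  moreover have "nonneg_coeffs 1"
    using nonneg_coeffs_monom [of 1 0] by (simp add: monom_0 one_pCons)
  ultimately show ?case by (intro exI [of _ 1]) simp
next
  case (Suc d)
  have "\<not> constant (poly K)" using Suc by (simp add: constant_degree)
  then obtain z where z: "poly K z = 0" using fundamental_theorem_of_algebra by blast
  then obtain L where L: "K = [:- z, 1:] * L" by (metis poly_eq_0_iff_dvd dvdE)
  have "K \<noteq> 0" using Suc.hyps by auto
  then have "degree K = 1 + degree L" unfolding L by (subst degree_mult_eq) auto
  with Suc have "d = degree L" by simp
  moreover have "poly L (of_real y) \<noteq> 0" if "y \<ge> 0" for y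
    using Suc.prems [OF that] unfolding L by auto
  ultimately obtain M where M: "nonneg_coeffs M" "coeff M 0 \<noteq> 0" "L dvd M"
    using Suc.hyps(1) by blast
  have nonreal: "z \<noteq> of_real y" if "y \<ge> 0" for y
    using Suc.prems [OF that] z by auto
  obtain M' where M': "nonneg_coeffs M'" "coeff M' 0 \<noteq> 0" "[:- z, 1:] dvd M'"
    using linear_dvd_nonneg_coeffs [OF nonreal] by blast
  have "nonneg_coeffs (M' * M)" by (rule nonneg_coeffs_mult [OF M'(1) M(1)])
  moreover have "coeff (M' * M) 0 \<noteq> 0" using M M' by (simp add: coeff_mult)
  moreover have "K dvd M' * M" unfolding L by (rule mult_dvd_mono [OF M'(3) M(3)])
  ultimately show ?case by blast
qed

text \<open>Otherwise K divides some M with nonnegative coefficients and positive constant term. The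
  recurrence makes the series times K a polynomial, hence also the series times M; but coefficient k
  of the latter is at least \<Phi> k times the constant term of M, so it never vanishes.\<close>

lemma positive_recurrence_root:
  fixes \<Phi> :: "nat \<Rightarrow> real" and K :: "complex poly"
  assumes pos: "\<And>k. \<Phi> k > 0"
    and rec: "\<And>k. k > d \<Longrightarrow> (Abs_fps (\<lambda>k. complex_of_real (\<Phi> k)) * fps_of_poly K) $ k = 0"
  shows "\<exists>y::real. y \<ge> 0 \<and> poly K (of_real y) = 0"
proof (rule ccontr)
  assume "\<not> ?thesis"
  then have "poly K (of_real y) \<noteq> 0" if "y \<ge> 0" for y
    using that by blast
  then obtain M where M: "nonneg_coeffs M" "coeff M 0 \<noteq> 0" "K dvd M"
    using dvd_nonneg_coeffs by metis
  obtain L where L: "M = K * L" using M(3) by blast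
  obtain m where m: "\<And>i. m i \<ge> 0" "\<And>i. coeff M i = complex_of_real (m i)"
    using M(1) unfolding nonneg_coeffs_def by metis
  have "m 0 > 0" using M(2) m(1) [of 0] m(2) [of 0] by (simp add: less_le)
  define F where "F = Abs_fps (\<lambda>k. complex_of_real (\<Phi> k))"
  define N where "N = poly_of_list (map (fps_nth (F * fps_of_poly K)) [0..<Suc d])"
  have "F * fps_of_poly K = fps_of_poly N"
  proof (rule fps_ext)
    fix k
    show "(F * fps_of_poly K) $ k = fps_of_poly N $ k"
      using rec [of k] by (cases "k \<le> d") (auto simp: N_def F_def nth_default_def simp del: upt_Suc)
  qed
  then have "F * fps_of_poly M = fps_of_poly (N * L)"
    unfolding L by (simp add: fps_of_poly_mult mult.assoc [symmetric])
  then have "(F * fps_of_poly M) $ Suc (degree (N * L)) = 0"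
    by (simp add: coeff_eq_0)
  moreover define k where "k = Suc (degree (N * L))"
  ultimately have "complex_of_real (\<Sum>i=0..k. \<Phi> i * m (k - i)) = 0"
    by (simp add: F_def fps_mult_nth m)
  then have "(\<Sum>i=0..k. \<Phi> i * m (k - i)) = 0"
    unfolding of_real_eq_0_iff .
  moreover have "\<Phi> k * m 0 \<le> (\<Sum>i=0..k. \<Phi> i * m (k - i))"
    using member_le_sum [of k "{0..k}" "\<lambda>i. \<Phi> i * m (k - i)"] pos m(1)
    by (simp add: less_imp_le)
  ultimately show False using pos [of k] \<open>m 0 > 0\<close> by (simp add: mult_le_0_iff not_less [symmetric])
qed

section \<open>Heights and their weights\<close>

definition fps_nonneg :: "real fps \<Rightarrow> bool" where
  "fps_nonneg f \<longleftrightarrow> (\<forall>k. f $ k \<ge> 0)"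

lemma fps_nonneg_add: "fps_nonneg f \<Longrightarrow> fps_nonneg g \<Longrightarrow> fps_nonneg (f + g)"
  by (simp add: fps_nonneg_def)

lemma fps_nonneg_mult: "fps_nonneg f \<Longrightarrow> fps_nonneg g \<Longrightarrow> fps_nonneg (f * g)"
  by (simp add: fps_nonneg_def fps_mult_nth sum_nonneg)

lemma fps_nonneg_shift: "fps_nonneg f \<Longrightarrow> fps_nonneg (fps_shift i f)"
  by (simp add: fps_nonneg_def)

lemma fps_nonneg_const: "fps_nonneg f \<Longrightarrow> fps_nonneg (fps_const (f $ 0))"
  by (simp add: fps_nonneg_def)

lemma fps_nonneg_ones: "fps_nonneg (Abs_fps (\<lambda>_. 1))"
  by (simp add: fps_nonneg_def)

lemmas fps_nonneg_intros =
  fps_nonneg_add fps_nonneg_mult fps_nonneg_shift fps_nonneg_const fps_nonneg_ones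

lemma fps_nonneg_shrub_step: "fps_nonneg f \<Longrightarrow> fps_nonneg (shrub_step f)"
  unfolding shrub_step_def Let_def by (intro fps_nonneg_intros)

lemma fps_nonneg_funpow_shrub_step: "fps_nonneg f \<Longrightarrow> fps_nonneg ((shrub_step ^^ n) f)"
  by (induction n) (auto intro: fps_nonneg_shrub_step)

lemma fps_shift_diff: "fps_shift i (f - g) = fps_shift i f - fps_shift i (g :: 'a :: ab_group_add fps)"
  by (rule fps_ext) simp

lemma fps_shift_const_mult: "fps_shift i (fps_const c * f) = fps_const c * fps_shift i (f :: 'a :: comm_ring_1 fps)"
  by (rule fps_ext) simp

lemma shrub_step_diff: "shrub_step (f - g) = shrub_step f - shrub_step (g :: 'a :: comm_ring_1 fps)"
proof -
  let ?u = "Abs_fps (\<lambda>_. 1) :: 'a fps" and ?D = "fps_shift 1 :: 'a fps \<Rightarrow> 'a fps"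
  have c: "fps_const ((f - g) $ 0) = fps_const (f $ 0) - fps_const (g $ 0)" by simp
  have "?u * (fps_const (f $ 0) - fps_const (g $ 0) + (?D f - ?D g)) + (?D (?D f) - ?D (?D g)) =
      (?u * (fps_const (f $ 0) + ?D f) + ?D (?D f)) - (?u * (fps_const (g $ 0) + ?D g) + ?D (?D g))"
    by (simp only: ring_distribs) simp
  then show ?thesis
    unfolding shrub_step_def Let_def fps_shift_diff c
    by (simp only: fps_shift_diff) (simp only: ring_distribs, simp)
qed

lemma shrub_step_const_mult: "shrub_step (fps_const c * f) = fps_const c * shrub_step (f :: 'a :: comm_ring_1 fps)"
proof -
  let ?u = "Abs_fps (\<lambda>_. 1) :: 'a fps" and ?D = "fps_shift 1 :: 'a fps \<Rightarrow> 'a fps"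
  let ?c = "fps_const c"
  have c: "fps_const ((?c * f) $ 0) = ?c * fps_const (f $ 0)" by simp
  have "?u * (?c * fps_const (f $ 0) + ?c * ?D f) + ?c * ?D (?D f) =
      ?c * (?u * (fps_const (f $ 0) + ?D f) + ?D (?D f))"
    by (simp only: ring_distribs mult.left_commute)
  then show ?thesis
    unfolding shrub_step_def Let_def fps_shift_const_mult c
    by (simp only: fps_shift_const_mult) (simp only: ring_distribs mult.left_commute)
qed

lemma funpow_shrub_step_diff: "(shrub_step ^^ n) (f - g) = (shrub_step ^^ n) f - (shrub_step ^^ n) (g :: 'a ::
    comm_ring_1 fps)"
  by (induction n) (simp_all add: shrub_step_diff)

lemma funpow_shrub_step_const_mult:
  "(shrub_step ^^ n) (fps_const c * f) = fps_const c * (shrub_step ^^ n) (f :: 'a :: comm_ring_1 fps)"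
  by (induction n) (simp_all add: shrub_step_const_mult)

section \<open>Comparison of counts at different heights\<close>

definition shrub_count :: "nat \<Rightarrow> nat \<Rightarrow> real" where
  "shrub_count n k = (shrub_step ^^ n) 1 $ k"

lemma fps_nonneg_funpow_shrub_step_1: "fps_nonneg ((shrub_step ^^ n) 1)"
  by (rule fps_nonneg_funpow_shrub_step) (simp add: fps_nonneg_def)

lemma shrub_count_nonneg: "shrub_count n k \<ge> 0"
  using fps_nonneg_funpow_shrub_step_1 by (simp add: shrub_count_def fps_nonneg_def)

text \<open>Forests can be concatenated: after m shrubs only the words of height 0 are kept, and the
  rest starts afresh. The discarded part is nonnegative and stays so under the linear operator
  \<open>shrub_step\<close>.\<close>

lemma shrub_count_mult_le: "shrub_count m 0 * shrub_count n 0 \<le> shrub_count (m + n) 0"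
proof -
  have "fps_nonneg ((shrub_step ^^ m) 1 - fps_const (shrub_count m 0) * 1)"
    using shrub_count_nonneg by (auto simp: fps_nonneg_def shrub_count_def)
  then have "fps_nonneg ((shrub_step ^^ n) ((shrub_step ^^ m) 1 - fps_const (shrub_count m 0) * 1))"
    by (rule fps_nonneg_funpow_shrub_step)
  then show ?thesis
    unfolding funpow_shrub_step_diff funpow_shrub_step_const_mult
    by (simp add: fps_nonneg_def shrub_count_def add.commute [of m] funpow_add)
qed

text \<open>A shrub can fill up to three gaps, and its remaining entries can be new maxima that keep
  the height. Each case uses the matching summand of \<open>shrub_step\<close>; truncated
  subtraction covers heights below three.\<close>

lemma shrub_step_ge:
  assumes f: "fps_nonneg f"
  shows "shrub_step f $ (k - 3) \<ge> f $ k"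
proof -
  let ?u = "Abs_fps (\<lambda>_. 1) :: real fps" and ?D = "fps_shift 1 :: real fps \<Rightarrow> real fps"
  have D_add: "?D (g + h) = ?D g + ?D h" for g h by (rule fps_ext) simp
  define V where "V = ?u * (fps_const (f $ 0) + ?D f)"
  have eq: "shrub_step f = ?u * (?u * (?u * f)) + ?u * (?u * ?D f) + ?u * ?D (?D f) + ?D V + ?D (?D (?D f))"
    unfolding shrub_step_def Let_def V_def [symmetric] by (simp only: D_add distrib_left add.assoc)
  have n: "fps_nonneg (?u * (?u * (?u * f)))" "fps_nonneg (?u * (?u * ?D f))" "fps_nonneg (?u * ?D (?D f))"
    "fps_nonneg (?D V)" "fps_nonneg (?D (?D (?D f)))"
    unfolding V_def by (intro fps_nonneg_intros f)+
  have nn: "shrub_step f $ j \<ge> (?u * (?u * (?u * f))) $ j" "shrub_step f $ j \<ge> (?u * (?u * ?D f)) $ j"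
    "shrub_step f $ j \<ge> (?u * ?D (?D f)) $ j" "shrub_step f $ j \<ge> ?D (?D (?D f)) $ j" for j
    using n unfolding eq fps_nonneg_def by (simp_all add: add_nonneg_nonneg)
  consider "k = 0" | "k = 1" | "k = 2" | m where "k = Suc (Suc (Suc m))"
    by (metis One_nat_def numeral_2_eq_2 not0_implies_Suc)
  then show ?thesis
    using nn [of "k - 3"] by cases (simp_all add: numeral_2_eq_2 numeral_3_eq_3)
qed

lemma shrub_count_le_Suc: "shrub_count n k \<le> shrub_count (Suc n) (k - 3)"
  using shrub_step_ge [OF fps_nonneg_funpow_shrub_step_1] by (simp add: shrub_count_def)

text \<open>Each shrub can close three gaps, so k further shrubs are ample. An exponential bound at
  height 0 thus extends to every fixed height with the same base.\<close>

lemma shrub_count_le: "shrub_count n k \<le> shrub_count (n + k) 0"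
proof -
  have "shrub_count n k \<le> shrub_count (n + m) (k - 3 * m)" for m
  proof (induction m)
    case (Suc m)
    then show ?case
      using shrub_count_le_Suc [of "n + m" "k - 3 * m"] by (simp add: diff_diff_add add.commute)
  qed simp
  from this [of k] show ?thesis by simp
qed

lemma shrub_count_mono: "m \<le> n \<Longrightarrow> shrub_count m 0 \<le> shrub_count n 0"
  by (rule lift_Suc_mono_le [where f = "\<lambda>n. shrub_count n 0"]) (use shrub_count_le_Suc [of _ 0] in auto)

lemma shrub_count_ge_1: "shrub_count n 0 \<ge> 1"
  using shrub_count_mono [of 0 n] by (simp add: shrub_count_def)

text \<open>Three new maxima reach any height. This provides the positivity that
  \<open>positive_recurrence_root\<close> requires.\<close>

lemma shrub_count_1_pos: "shrub_count 1 k > 0"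
proof -
  let ?u = "Abs_fps (\<lambda>_. 1) :: real fps" and ?D = "fps_shift 1 :: real fps \<Rightarrow> real fps"
  define W where "W = ?D (?u * (fps_const ((1 :: real fps) $ 0) + ?D 1) + ?D (?D 1))"
  have "shrub_step 1 - ?u * (?u * ?u) = ?u * (?u * ?D 1 + ?D (?D 1)) + W"
    unfolding shrub_step_def Let_def W_def [symmetric] by (simp add: distrib_left)
  moreover have "fps_nonneg (?u * (?u * ?D 1 + ?D (?D 1)) + W)"
    unfolding W_def by (intro fps_nonneg_intros) (simp_all add: fps_nonneg_def)
  ultimately have "fps_nonneg (shrub_step 1 - ?u * (?u * ?u))" by simp
  then have "shrub_count 1 k \<ge> (?u * (?u * ?u)) $ k"
    by (simp add: shrub_count_def fps_nonneg_def)
  moreover have "(?u * (?u * ?u)) $ k > 0"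
    unfolding fps_mult_nth by (intro sum_pos) (auto intro!: sum_pos mult_pos_pos)
  ultimately show ?thesis by simp
qed

section \<open>Weighted counts and the upper bound\<close>

definition weight :: "real \<Rightarrow> real fps \<Rightarrow> real \<Rightarrow> bool" where
  "weight t f w \<longleftrightarrow> (\<lambda>k. f $ k * t ^ k) sums w"

lemma weight_add: "weight t f v \<Longrightarrow> weight t g w \<Longrightarrow> weight t (f + g) (v + w)"
  unfolding weight_def fps_add_nth distrib_right by (rule sums_add)

lemma weight_const: "weight t (fps_const c) c"
  unfolding weight_def using sums_finite [of "{0}" "\<lambda>k. fps_const c $ k * t ^ k"] by simp

lemma weight_shift:
  assumes "weight t f w" "t \<noteq> 0"
  shows "weight t (fps_shift 1 f) ((w - f $ 0) / t)"
proof -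
  have "(\<lambda>k. f $ Suc k * t ^ Suc k) sums (w - f $ 0)"
    using assms(1) sums_Suc_iff [of "\<lambda>k. f $ k * t ^ k" "w - f $ 0"] by (simp add: weight_def)
  from sums_divide [OF this, of t] assms(2) show ?thesis
    by (simp add: weight_def)
qed

lemma weight_ones_mult:
  assumes "weight t f w" "fps_nonneg f" "0 < t" "t < 1"
  shows "weight t (Abs_fps (\<lambda>_. 1) * f) (w / (1 - t))"
proof -
  have "(\<lambda>k. \<Sum>i\<le>k. (t ^ i) * (f $ (k - i) * t ^ (k - i))) sums ((\<Sum>k. t ^ k) * (\<Sum>k. f $ k
      * t ^ k))"
  proof (rule Cauchy_product_sums)
    show "summable (\<lambda>k. norm (t ^ k))" using assms by (simp add: summable_geometric)
    show "summable (\<lambda>k. norm (f $ k * t ^ k))"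
      using assms sums_summable by (fastforce simp: weight_def fps_nonneg_def)
  qed
  moreover have "(\<Sum>i\<le>k. (t ^ i) * (f $ (k - i) * t ^ (k - i))) = (Abs_fps (\<lambda>_. 1) * f) $ k * t ^ k" for k
    unfolding fps_mult_nth sum_distrib_right atMost_atLeast0
    by (intro sum.cong) (auto simp: power_add [symmetric] mult.left_commute [of "t ^ _"])
  moreover have "(\<Sum>k. t ^ k) = 1 / (1 - t)" using assms by (simp add: suminf_geometric)
  moreover have "(\<Sum>k. f $ k * t ^ k) = w" using assms by (simp add: weight_def sums_iff)
  ultimately show ?thesis by (simp add: weight_def)
qed

text \<open>A new maximum costs a factor u = 1/(1 - t), a filled gap at most s = 1/t. Dropping the
  boundary terms bounds the whole factor by u^3 + u^2 s + 2 u s^2 + s^3, which is the stated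
  quotient: the reciprocal of the x for which the kernel vanishes at t.\<close>

lemma weight_shrub_step:
  assumes "weight t f w" "fps_nonneg f" "0 < t" "t < 1"
  shows "\<exists>w'. weight t (shrub_step f) w' \<and> w' \<le> (1 - t + t^3) / (t * (1 - t))^3 * w"
proof -
  define D1 D2 D3 where "D1 = (w - f $ 0) / t" and "D2 = (D1 - f $ 1) / t" and "D3 = (D2 - f $ 2) / t"
  define V where "V = (f $ 0 + D1) / (1 - t)"
  have f0: "f $ k \<ge> 0" for k using assms by (simp add: fps_nonneg_def)
  have t: "t \<noteq> 0" using assms by simp
  have w1: "weight t (fps_shift 1 f) D1" using weight_shift [OF assms(1) t] by (simp add: D1_def)
  have w2: "weight t (fps_shift 1 (fps_shift 1 f)) D2" using weight_shift [OF w1 t] by (simp add: D2_def)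
  have wV: "weight t (Abs_fps (\<lambda>_. 1) * (fps_const (f $ 0) + fps_shift 1 f)) V"
    unfolding V_def by (intro weight_ones_mult weight_add weight_const w1 fps_nonneg_intros assms)
  have "weight t (shrub_step f) ((((w / (1 - t) + D1) / (1 - t)) + D2) / (1 - t) + (V + D2 - (f $ 0 + f $ 1 + f $ 2)) / t)"
    unfolding shrub_step_def Let_def
  proof (intro weight_add weight_ones_mult weight_const w1 w2 fps_nonneg_intros assms)
    show "weight t (fps_shift 1 (Abs_fps (\<lambda>_. 1) * (fps_const (f $ 0) + fps_shift 1 f) + fps_shift 1
        (fps_shift 1 f)))
        ((V + D2 - (f $ 0 + f $ 1 + f $ 2)) / t)"
      using weight_shift [OF weight_add [OF wV w2] t] by (simp add: numeral_2_eq_2)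
  qed
  moreover have "(((w / (1 - t) + D1) / (1 - t)) + D2) / (1 - t) + (V + D2 - (f $ 0 + f $ 1 + f $ 2)) / t
      \<le> (1 - t + t^3) / (t * (1 - t))^3 * w"
  proof -
    define u where "u = 1 / (1 - t)"
    define s where "s = 1 / t"
    have u: "u \<ge> 1" and s: "s > 0" using assms by (simp_all add: u_def s_def)
    have D1: "D1 \<le> s * w - s * f $ 0" and D2: "D2 \<le> s * D1" and D3: "(D2 - f $ 2) / t \<le> s * D2"
      using f0 [of 0] f0 [of 1] f0 [of 2] assms(3) by (auto simp: D1_def D2_def s_def field_simps)
    have D1': "D1 \<le> s * w" using D1 f0 [of 0] s by (smt (verit) mult_nonneg_nonneg)
    have D2': "D2 \<le> s * (s * w)" using D2 D1' s by (smt (verit) mult_left_mono)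
    \<comment> \<open>The constant added for \<open>append_next\<close> is absorbed by the one that
      the shift loses, as s \<ge> 1.\<close>
    have V: "V \<le> u * (s * w)"
    proof -
      have "s \<ge> 1" using assms by (simp add: s_def)
      then have "f $ 0 \<le> s * f $ 0" using f0 [of 0] by (simp add: mult_right_le_one_le mult_le_cancel_right1)
      then have "f $ 0 + D1 \<le> s * w" using D1 by simp
      then show ?thesis using u by (simp add: V_def u_def divide_right_mono assms less_imp_le)
    qed
    have "(((w / (1 - t) + D1) / (1 - t)) + D2) / (1 - t) + (V + D2 - (f $ 0 + f $ 1 + f $ 2)) / t
        \<le> u * (u * (u * w + D1) + D2) + s * (V + D2)"
      using f0 [of 0] f0 [of 1] f0 [of 2] assms(3) by (simp add: u_def s_def divide_right_mono)
    also have "\<dots> \<le> u * (u * (u * w + s * w) + s * (s * w)) + s * (u * (s * w) + s * (s * w))"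
      using u s D1' D2' V by (intro add_mono mult_left_mono order_refl) auto
    also have "\<dots> = (1 - t + t^3) / (t * (1 - t))^3 * w"
      using assms(3,4) by (simp add: u_def s_def divide_simps) algebra
    finally show ?thesis .
  qed
  ultimately show ?thesis by blast
qed

lemma shrub_count_upper:
  assumes "0 < t" "t < 1"
  shows "shrub_count n 0 \<le> ((1 - t + t^3) / (t * (1 - t))^3) ^ n"
proof -
  define P where "P = (1 - t + t^3) / (t * (1 - t))^3"
  have "P \<ge> 0" using assms by (simp add: P_def)
  have "\<exists>w. weight t ((shrub_step ^^ n) 1) w \<and> w \<le> P ^ n"
  proof (induction n)
    case 0
    show ?case using weight_const [of t 1] by auto
  next
    case (Suc n)
    then obtain w where w: "weight t ((shrub_step ^^ n) 1) w" "w \<le> P ^ n" by blast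
    from weight_shrub_step [OF w(1) fps_nonneg_funpow_shrub_step_1 assms]
    obtain w' where "weight t (shrub_step ((shrub_step ^^ n) 1)) w'" "w' \<le> P * w" unfolding P_def by blast
    moreover have "P * w \<le> P * P ^ n" using w(2) \<open>P \<ge> 0\<close> by (rule mult_left_mono)
    ultimately show ?case by (intro exI [of _ w']) auto
  qed
  then obtain w where w: "(\<lambda>k. shrub_count n k * t ^ k) sums w" "w \<le> P ^ n"
    by (auto simp: weight_def shrub_count_def)
  have "shrub_count n 0 \<le> w"
    using sum_le_suminf [of "\<lambda>k. shrub_count n k * t ^ k" "{0}"] w assms shrub_count_nonneg
    by (simp add: sums_iff)
  then show ?thesis using w(2) by (simp add: P_def)
qed

lemma kernel_root_exists:
  assumes \<beta>: "0 < \<beta>" "\<And>n. shrub_count n 0 \<le> \<beta> ^ n" and x: "0 < x" "x * \<beta> < 1"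
  shows "\<exists>y::real. y \<ge> 0 \<and> x * (1 - y + y^3) + y^3 * (y - 1)^3 = 0"
proof -
  have summable: "summable (\<lambda>n. shrub_count n k * x ^ n)" for k
  proof (rule summable_comparison_test')
    show "summable (\<lambda>n. \<beta> ^ k * (x * \<beta>) ^ n)"
      using \<beta> x by (intro summable_mult summable_geometric) auto
    show "norm (shrub_count n k * x ^ n) \<le> \<beta> ^ k * (x * \<beta>) ^ n" for n
    proof -
      have "shrub_count n k \<le> \<beta> ^ (n + k)"
        using shrub_count_le [of n k] \<beta>(2) [of "n + k"] by linarith
      then show ?thesis
        using shrub_count_nonneg [of n k] x by (simp add: power_add power_mult_distrib mult_ac)
    qed
  qed
  define \<Phi> where "\<Phi> k = (\<Sum>n. shrub_count n k * x ^ n)" for k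
  have \<Phi>: "(\<lambda>n. shrub_count n k * x ^ n) sums \<Phi> k" for k
    using summable unfolding \<Phi>_def by (rule summable_sums)
  have pos: "\<Phi> k > 0" for k
  proof -
    have "shrub_count 1 k * x ^ 1 \<le> \<Phi> k"
      using sum_le_suminf [OF summable, of "{1}" k] shrub_count_nonneg x by (simp add: \<Phi>_def)
    moreover have "shrub_count 1 k * x ^ 1 > 0" using shrub_count_1_pos x by simp
    ultimately show ?thesis by linarith
  qed
  have rec: "\<Phi> k - 3 * \<Phi> (k + 1) + 3 * \<Phi> (k + 2) - \<Phi> (k + 3)
      + x * (\<Phi> (k + 6) - \<Phi> (k + 5) + \<Phi> (k + 3)) = 0" if k: "k \<ge> 1" for k
  proof -
    define s where "s n = shrub_count n k - 3 * shrub_count n (k + 1) + 3 * shrub_count n (k + 2) - shrub_count n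
        (k + 3)" for n
    define t where "t n = shrub_count n (k + 6) - shrub_count n (k + 5) + shrub_count n (k + 3)" for n
    \<comment> \<open>Before the first shrub all heights are 0. The vanishing term lets the
      summation move from n to \<open>Suc n\<close>.\<close>
    have s0: "s 0 = 0"
      using shrub_step_recurrence(2) [where 'a=real] k by (simp add: s_def shrub_count_def)
    have st: "s (Suc n) = - t n" for n
      using shrub_step_recurrence(1) [OF k, where 'a=real, of n] by (simp only: s_def t_def shrub_count_def)
    have "(\<lambda>n. s n * x ^ n) sums (\<Phi> k - 3 * \<Phi> (k + 1) + 3 * \<Phi> (k + 2) - \<Phi> (k + 3))"
      unfolding s_def ring_distribs mult.assoc by (intro sums_add sums_diff sums_mult \<Phi>)
    then have "(\<lambda>n. s (Suc n) * x ^ Suc n) sums (\<Phi> k - 3 * \<Phi> (k + 1) + 3 * \<Phi> (k + 2) -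
        \<Phi> (k + 3))"
      by (subst sums_Suc_iff) (simp add: s0)
    moreover have "(\<lambda>n. x * (t n * x ^ n)) sums (x * (\<Phi> (k + 6) - \<Phi> (k + 5) + \<Phi> (k + 3)))"
      unfolding t_def ring_distribs by (intro sums_add sums_diff sums_mult \<Phi>)
    then have "(\<lambda>n. s (Suc n) * x ^ Suc n) sums (- (x * (\<Phi> (k + 6) - \<Phi> (k + 5) + \<Phi> (k + 3))))"
      using sums_minus by (fastforce simp: st mult_ac)
    ultimately show ?thesis using sums_unique2 by fastforce
  qed
  define cx where "cx = complex_of_real x"
  \<comment> \<open>The coefficients of y^3 (y - 1)^3 + x (1 - y + y^3), lowest first; the
    recurrence at k is coefficient k + 6 of the product with the series.\<close>
  define K where "K = [:cx, - cx, 0, cx - 1, 3, - 3, 1:]"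
  have "\<exists>y::real. y \<ge> 0 \<and> poly K (of_real y) = 0"
  proof (rule positive_recurrence_root [OF pos])
    fix m :: nat assume "6 < m"
    then obtain k where k: "m = k + 6" "k \<ge> 1" by (metis add.commute less_imp_add_positive less_eq_Suc_le One_nat_def)
    define F where "F = Abs_fps (\<lambda>k. complex_of_real (\<Phi> k))"
    have eq: "F * fps_of_poly K = fps_const cx * F - fps_const cx * (fps_X * F) + fps_const (cx - 1) * (fps_X ^ 3 * F)
        + fps_const 3 * (fps_X ^ 4 * F) - fps_const 3 * (fps_X ^ 5 * F) + fps_X ^ 6 * F"
      by (simp add: K_def fps_of_poly_pCons algebra_simps power_numeral_reduce flip: fps_const_neg numeral_fps_const)
    have "(F * fps_of_poly K) $ m = complex_of_real (\<Phi> k - 3 * \<Phi> (k + 1) + 3 * \<Phi> (k + 2) - \<Phi> (k + 3)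
      + x * (\<Phi> (k + 6) - \<Phi> (k + 5) + \<Phi> (k + 3)))"
      unfolding eq by (simp add: k fps_X_power_mult_nth fps_X_mult_nth) (simp add: F_def cx_def algebra_simps)
    then show "(F * fps_of_poly K) $ m = 0" unfolding rec [OF k(2)] by simp
  qed
  then obtain y :: real where y: "y \<ge> 0" "poly K (of_real y) = 0" by blast
  have "poly K (of_real y) = complex_of_real (x * (1 - y + y^3) + y^3 * (y - 1)^3)"
    by (simp add: K_def cx_def algebra_simps power_numeral_reduce)
  with y show ?thesis by (metis of_real_eq_0_iff)
qed

section \<open>The growth rate\<close>

text \<open>The minimum is at 1/sqrt 3, for which a = 577/1000 stands in: (y - a)^2 (y + 2 a) = y^3
  - 3 a^2 y + 2 a^3, and 1213/1000000 is the defect 1 - 3 a^2. The bound 61/100 is chosen to exceed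
  39/64.\<close>

lemma cubic_lower_bound:
  fixes y :: real
  assumes "y \<ge> 0"
  shows "61 / 100 \<le> 1 - y + y^3"
proof (cases "y \<le> 1")
  case True
  have "1 - y + y^3 - 61 / 100 = (y - 577 / 1000)^2 * (y + 1154 / 1000)
      + (1213 / 1000000) * (1 - y) + (39 / 100 - 1213 / 1000000 - 2 * (577 / 1000)^3)"
    by (simp add: field_simps power2_eq_square power3_eq_cube)
  moreover have "(y - 577 / 1000)^2 * (y + 1154 / 1000) \<ge> 0" using assms by simp
  moreover have "(1213 / 1000000) * (1 - y) \<ge> 0" using True by simp
  moreover have "39 / 100 - 1213 / 1000000 - 2 * (577 / 1000)^3 \<ge> (0::real)" by (simp add: power3_eq_cube)
  ultimately show ?thesis by linarith
next
  case False
  then have "y ^ 1 \<le> y ^ 3" by (intro power_increasing) auto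
  then show ?thesis by simp
qed

text \<open>The quotient vanishes at both ends and is 1/40 at 1/2, so its maximum is interior. There
  the numerator of the derivative is zero, and up to sign it is (t (1 - t))^2 times the quartic in
  t.\<close>

lemma kernel_saddle_point:
  obtains t :: real where "0 < t" "t < 1" "3 * t^4 - 5 * t^2 + 8 * t - 3 = 0"
    "\<forall>y\<in>{0..1}. (y * (1 - y))^3 / (1 - y + y^3) \<le> (t * (1 - t))^3 / (1 - t + t^3)"
    "1 / 40 \<le> (t * (1 - t))^3 / (1 - t + t^3)"
proof -
  define \<phi> where "\<phi> y = (y * (1 - y))^3 / (1 - y + y^3)" for y :: real
  have N: "1 - y + y^3 > 0" if "y \<ge> 0" for y :: real
    using cubic_lower_bound [OF that] by linarith
  have "continuous_on {0..1} \<phi>"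
    unfolding \<phi>_def using N by (intro continuous_intros) (auto simp: less_imp_neq [symmetric])
  then obtain t where t: "t \<in> {0..1}" and max: "\<And>y. y \<in> {0..1} \<Longrightarrow> \<phi> y \<le> \<phi> t"
    using continuous_attains_sup [of "{0..1}" \<phi>] by auto
  have half: "1 / 40 \<le> \<phi> t"
    using max [of "1 / 2"] by (simp add: \<phi>_def power3_eq_cube)
  then have "t \<noteq> 0" "t \<noteq> 1" by (auto simp: \<phi>_def)
  with t have t01: "0 < t" "t < 1" by auto
  define d where "d = (3 * (t * (1 - t))^2 * (1 - 2 * t) * (1 - t + t^3) - (t * (1 - t))^3 * (3 * t^2 - 1)) / (1 -
      t + t^3)^2"
  have "(\<phi> has_real_derivative d) (at t)"
    unfolding \<phi>_def d_def using N [of t] t01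
    by (auto intro!: derivative_eq_intros simp: field_simps power2_eq_square power3_eq_cube)
  moreover have "\<forall>y. \<bar>t - y\<bar> < min t (1 - t) \<longrightarrow> \<phi> y \<le> \<phi> t"
    by (intro allI impI max) (auto simp: abs_less_iff)
  moreover have "0 < min t (1 - t)" using t01 by simp
  ultimately have "d = 0" using DERIV_local_max by blast
  then have "(t * (1 - t))^2 * (3 * t^4 - 5 * t^2 + 8 * t - 3) = 0"
    using N [of t] t01 unfolding d_def by (simp add: power2_eq_square power3_eq_cube) algebra
  then have "3 * t^4 - 5 * t^2 + 8 * t - 3 = 0" using t01 by simp
  then show thesis
    using that t01 max half by (auto simp: \<phi>_def)
qed

text \<open>Elimination of t: e^4 times the quartic in r is a polynomial of degree 24 in t that is
  divisible by the saddle quartic; the long factor is the quotient.\<close>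

lemma saddle_value_quartic:
  fixes t r :: real
  assumes q: "3 * t^4 - 5 * t^2 + 8 * t - 3 = 0" and r: "r * (t * (1 - t))^3 = 1 - t + t^3" and t: "0 < t" "t < 1"
  shows "729 * r^4 - 28674 * r^3 - 15505 * r^2 - 25758 * r + 621 = 0"
proof -
  define e where "e = (t * (1 - t))^3"
  define n where "n = 1 - t + t^3"
  have "e^4 * (729 * r^4 - 28674 * r^3 - 15505 * r^2 - 25758 * r + 621) =
      729 * (r * e)^4 - 28674 * (r * e)^3 * e - 15505 * (r * e)^2 * e^2 - 25758 * (r * e) * e^3 + 621 * e^4"
    by algebra
  also have "\<dots> = 729 * n^4 - 28674 * n^3 * e - 15505 * n^2 * e^2 - 25758 * n * e^3 + 621 * e^4"
    using r unfolding e_def n_def by simp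
  also have "\<dots> = (3 * t^4 - 5 * t^2 + 8 * t - 3) *
      (207 * t^20 - 2484 * t^19 + 14007 * t^18 - 41646 * t^17 + 55367 * t^16 + 27320 * t^15 - 231923 * t^14
       + 418774 * t^13 - 420264 * t^12 + 256930 * t^11 - 75153 * t^10 - 50002 * t^9 + 108558 * t^8 - 83382 * t^7
       + 5903 * t^6 + 41524 * t^5 - 31899 * t^4 + 8514 * t^3 - 189 * t^2 + 324 * t - 243)"
    unfolding e_def n_def by algebra
  finally have "e^4 * (729 * r^4 - 28674 * r^3 - 15505 * r^2 - 25758 * r + 621) = 0"
    using q by simp
  moreover have "e \<noteq> 0" using t by (simp add: e_def)
  ultimately show ?thesis by simp
qed

text \<open>The expansion of the quartic at 39 has only one sign change.\<close>

lemma quartic_strict_mono: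
  fixes s t :: real
  assumes "39 \<le> s" "s < t"
  shows "729 * s^4 - 28674 * s^3 - 15505 * s^2 - 25758 * s + 621 <
    729 * t^4 - 28674 * t^3 - 15505 * t^2 - 25758 * t + 621"
proof -
  have shift: "729 * t^4 - 28674 * t^3 - 15505 * t^2 - 25758 * t + 621 =
      729 * (t - 39)^4 + 85050 * (t - 39)^3 + 3282491 * (t - 39)^2 + 40899594 * (t - 39) - 39001563" for t :: real
    by algebra
  define u v where "u = s - 39" and "v = t - 39"
  have "0 \<le> u" "u < v" using assms by (simp_all add: u_def v_def)
  moreover from this have "u^n \<le> v^n" for n by (intro power_mono) auto
  from this [of 4] this [of 3] this [of 2]
  have "u^4 \<le> v^4" "u^3 \<le> v^3" "u^2 \<le> v^2" .
  ultimately show ?thesis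
    unfolding shift u_def [symmetric] v_def [symmetric] by linarith
qed

text \<open>A variant of Fekete's lemma. One index where a exceeds \<beta>^n gives, by
  supermultiplicativity, a bound along its multiples, which monotonicity extends to all indices at
  the cost of a constant factor.\<close>

lemma root_limit_supermultiplicative:
  fixes a :: "nat \<Rightarrow> real" and r :: real
  assumes mult: "\<And>m n. a m * a n \<le> a (m + n)" and mono: "\<And>m n. m \<le> n \<Longrightarrow> a m \<le>
      a n" and one: "\<And>n. a n \<ge> 1"
    and upper: "\<And>n. a n \<le> r ^ n" and r: "r > 1"
    and lower: "\<And>\<beta>. 0 < \<beta> \<Longrightarrow> \<beta> < r \<Longrightarrow> \<exists>n. a n > \<beta> ^ n"
  shows "(\<lambda>n. root n (a n)) \<longlonglongrightarrow> r"
proof (rule order_tendstoI)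
  fix b assume "r < b"
  have le_r: "root n (a n) \<le> r" if "n > 0" for n
    using real_root_le_mono [OF that upper [of n]] r that by (simp add: real_root_power_cancel)
  have "root n (a n) < b" if "n > 0" for n
    using le_less_trans [OF le_r [OF that] \<open>r < b\<close>] .
  then show "\<forall>\<^sub>F n in sequentially. root n (a n) < b"
    by (intro eventually_sequentiallyI [of 1]) simp
next
  fix b assume "b < r"
  \<comment> \<open>Two bases are put between b and r: the growing power of \<beta> / \<beta>0
    absorbs the constant \<beta>^m left by the remainder modulo m.\<close>
  obtain \<beta>0 where "max 1 b < \<beta>0" "\<beta>0 < r" using dense [of "max 1 b" r] \<open>b < r\<close> r by auto
  moreover obtain \<beta> where "\<beta>0 < \<beta>" "\<beta> < r" using dense [OF \<open>\<beta>0 < r\<close>] by auto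
  ultimately have \<beta>: "1 < \<beta>0" "b < \<beta>0" "\<beta>0 < \<beta>" "\<beta> < r" by auto
  obtain m where m: "a m > \<beta> ^ m" using lower [of \<beta>] \<beta> by auto
  have "a 0 \<le> 1" using upper [of 0] by simp
  with m one [of 0] have "m > 0" by (cases m) auto
  have pow: "a m ^ q \<le> a (q * m)" for q
  proof (induction q)
    case (Suc q)
    have "a m * a m ^ q \<le> a m * a (q * m)"
      using Suc one [of m] by (intro mult_left_mono) auto
    then show ?case using mult [of m "q * m"] by simp
  qed (use one in simp)
  have key: "\<beta> ^ n \<le> a n * \<beta> ^ m" for n
  proof -
    have "n \<le> m * (n div m) + m"
      using mod_less_divisor [OF \<open>m > 0\<close>, of n] mult_div_mod_eq [of m n] by linarith
    then have "\<beta> ^ n \<le> \<beta> ^ (m * (n div m) + m)"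
      using \<beta> by (intro power_increasing) auto
    also have "\<dots> = (\<beta> ^ m) ^ (n div m) * \<beta> ^ m" by (simp add: power_add power_mult)
    also have "\<dots> \<le> a m ^ (n div m) * \<beta> ^ m"
      using m \<beta> by (intro mult_right_mono power_mono) auto
    also have "\<dots> \<le> a n * \<beta> ^ m"
      using pow [of "n div m"] mono [of "n div m * m" n] \<beta> by (intro mult_right_mono) auto
    finally show ?thesis .
  qed
  have ratio: "1 < \<beta> / \<beta>0" using \<beta> by simp
  then obtain n0 where n0: "\<beta> ^ m < (\<beta> / \<beta>0) ^ n0" using real_arch_pow by blast
  have "\<forall>\<^sub>F n in sequentially. (\<beta> / \<beta>0) ^ n \<ge> \<beta> ^ m"
  proof (rule eventually_sequentiallyI)
    fix n assume "n0 \<le> n"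
    then have "(\<beta> / \<beta>0) ^ n0 \<le> (\<beta> / \<beta>0) ^ n" using ratio by (intro power_increasing) auto
    with n0 show "(\<beta> / \<beta>0) ^ n \<ge> \<beta> ^ m" by linarith
  qed
  then show "\<forall>\<^sub>F n in sequentially. b < root n (a n)"
    using eventually_gt_at_top [of 0]
  proof eventually_elim
    case (elim n)
    have "\<beta>0 ^ n * \<beta> ^ m \<le> \<beta> ^ n"
      using elim(1) \<beta> by (simp add: power_divide field_simps)
    also have "\<dots> \<le> a n * \<beta> ^ m" by (rule key)
    finally have "\<beta>0 ^ n \<le> a n" using \<beta> by simp
    then have "\<beta>0 \<le> root n (a n)"
      using real_root_le_mono [OF elim(2) \<open>\<beta>0 ^ n \<le> a n\<close>] \<beta> elim(2) by (simp add:
          real_root_power_cancel)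
    then show ?case using \<beta> by linarith
  qed
qed

lemma shrub_count_growth:
  "\<exists>r::real. (729 * r^4 - 28674 * r^3 - 15505 * r^2 - 25758 * r + 621 = 0 \<and>
     (\<forall>t::real. 729 * t^4 - 28674 * t^3 - 15505 * t^2 - 25758 * t + 621 = 0 \<longrightarrow> t \<le> r)) \<and>
     (\<lambda>n. root n (shrub_count n 0)) \<longlonglongrightarrow> r \<and> \<bar>r - 39.88873\<bar> < 5 / 10^6"
proof -
  obtain t :: real where t: "0 < t" "t < 1" and q: "3 * t^4 - 5 * t^2 + 8 * t - 3 = 0"
    and max: "\<forall>y\<in>{0..1}. (y * (1 - y))^3 / (1 - y + y^3) \<le> (t * (1 - t))^3 / (1 - t + t^3)"
    and ge: "1 / 40 \<le> (t * (1 - t))^3 / (1 - t + t^3)"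
    by (rule kernel_saddle_point)
  define r where "r = (1 - t + t^3) / (t * (1 - t))^3"
  have N: "1 - y + y^3 > 0" if "y \<ge> 0" for y :: real
    using cubic_lower_bound [OF that] by linarith
  have e: "(t * (1 - t))^3 > 0" using t by simp
  have "r > 0" using e N [of t] t by (simp add: r_def)
  have re: "r * (t * (1 - t))^3 = 1 - t + t^3" using e t by (simp add: r_def)
  have quartic: "729 * r^4 - 28674 * r^3 - 15505 * r^2 - 25758 * r + 621 = 0"
    by (rule saddle_value_quartic [OF q re t])
  \<comment> \<open>Crude bounds suffice, as t (1 - t) is at most 1/4 and 39/64 < 61/100. From 39 on
    the quartic is strictly increasing, which makes r its largest root.\<close>
  have "r \<ge> 39"
  proof -
    have "t * (1 - t) \<le> 1 / 4"
      using zero_le_power2 [of "t - 1 / 2"] by (simp add: power2_eq_square field_simps)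
    then have "(t * (1 - t))^3 \<le> (1 / 4)^3" using t by (intro power_mono) auto
    then have "39 * (t * (1 - t))^3 \<le> 61 / 100" by (simp add: power3_eq_cube)
    also have "\<dots> \<le> 1 - t + t^3" using cubic_lower_bound t by simp
    finally show ?thesis using e by (simp add: r_def pos_le_divide_eq)
  qed
  have largest: "s \<le> r" if "729 * s^4 - 28674 * s^3 - 15505 * s^2 - 25758 * s + 621 = 0" for s
    using quartic_strict_mono [of r s] \<open>r \<ge> 39\<close> that quartic by fastforce
  define Q where "Q s = 729 * s^4 - 28674 * s^3 - 15505 * s^2 - 25758 * s + 621" for s :: real
  have mono: "39 \<le> s \<Longrightarrow> s < t \<Longrightarrow> Q s < Q t" for s t
    unfolding Q_def by (rule quartic_strict_mono)
  \<comment> \<open>The brackets are 39.88873 minus and plus 4/10^6.\<close>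
  have "Q r = 0" "Q 39.888726 < 0" "Q 39.888734 > 0"
    using quartic by (simp_all add: Q_def power_numeral_reduce)
  then have "39.888726 < r" "r < 39.888734"
    using mono [of r "39.888726"] mono [of "39.888734" r] \<open>r \<ge> 39\<close>
    by (cases r "39.888726 :: real" rule: linorder_cases; cases r "39.888734 :: real" rule: linorder_cases; force)+
  then have approx: "\<bar>r - 39.88873\<bar> < 5 / 10^6" unfolding abs_less_iff by simp
  have "(\<lambda>n. root n (shrub_count n 0)) \<longlonglongrightarrow> r"
  proof (rule root_limit_supermultiplicative [OF shrub_count_mult_le shrub_count_mono shrub_count_ge_1])
    show "shrub_count n 0 \<le> r ^ n" for n using shrub_count_upper [OF t] by (simp add: r_def)
    show "r > 1" using \<open>r \<ge> 39\<close> by simp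
    fix \<beta> assume \<beta>: "0 < \<beta>" "\<beta> < r"
    show "\<exists>n. shrub_count n 0 > \<beta> ^ n"
    proof (rule ccontr)
      assume "\<not> ?thesis"
      then have le: "shrub_count n 0 \<le> \<beta> ^ n" for n by (simp add: not_less)
      \<comment> \<open>With \<beta> as a bound, the kernel would have a root y \<ge> 0 for some x >
        1/r. On the unit interval this is excluded by the maximum 1/r of the quotient; beyond 1 the
        first term is positive and the second is nonnegative.\<close>
      have "1 / r < 1 / \<beta>" using \<beta> by (simp add: frac_less2)
      then obtain x where x: "1 / r < x" "x < 1 / \<beta>" using dense by blast
      have "0 < x" using x(1) \<open>r > 0\<close> by (meson divide_pos_pos less_trans zero_less_one)
      moreover have "x * \<beta> < 1" using x(2) \<beta> by (simp add: field_simps)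
      ultimately obtain y :: real where y: "y \<ge> 0" "x * (1 - y + y^3) + y^3 * (y - 1)^3 = 0"
        using kernel_root_exists [OF \<beta>(1) le] by blast
      have pos: "x * (1 - y + y^3) > 0" using \<open>0 < x\<close> N [OF y(1)] by simp
      show False
      proof (cases "y \<le> 1")
        case True
        have "(y * (1 - y))^3 / (1 - y + y^3) \<le> 1 / r"
          using max y(1) True by (simp add: r_def)
        then have "(y * (1 - y))^3 / (1 - y + y^3) < x" using x(1) by linarith
        then have "(y * (1 - y))^3 < x * (1 - y + y^3)" using N [OF y(1)] by (simp add: pos_divide_less_eq)
        moreover have "(y * (1 - y))^3 = - (y^3 * (y - 1)^3)" by algebra
        ultimately show False using y(2) by simp
      next
        case False
        then have "y^3 * (y - 1)^3 \<ge> 0" by simp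
        then show False using pos y(2) by linarith
      qed
    qed
  qed
  with quartic largest approx show ?thesis by blast
qed

theorem theorem18:
  shows "(let x = (fps_X :: real fps) in
           (4 * x^2 + 4 * x + 1)
         - (x^4 - 24 * x^3 + 8 * x^2 - 54 * x + 1) * H0^2
         + (15 * x^4 + 24 * x^3 - 71 * x^2 - 54 * x) * H0^4
         + (18 * x^5 - 215 * x^4 + 2 * x^3 - 360 * x^2) * H0^6
         + (3 * x^6 - 228 * x^5 - 213 * x^4 + 162 * x^3 + 729 * x^2) * H0^8
         - (138 * x^6 - 354 * x^5 - 1053 * x^4) * H0^10
         - (36 * x^7 - 751 * x^6 - 486 * x^5) * H0^12
         - (3 * x^8 - 420 * x^7 - 54 * x^6) * H0^14
         + 123 * x^8 * H0^16
         + 18 * x^9 * H0^18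
         + x^10 * H0^20 = 0)
       \<and> (\<exists>r::real.
            (729 * r^4 - 28674 * r^3 - 15505 * r^2 - 25758 * r + 621 = 0 \<and>
             (\<forall>t::real. 729 * t^4 - 28674 * t^3 - 15505 * t^2 - 25758 * t + 621 = 0 \<longrightarrow> t \<le> r)) \<and>
            (\<lambda>n. root n (real (card (binary_shrub_forests_321 n)))) \<longlonglongrightarrow> r \<and>
            \<bar>r - 39.88873\<bar> < 5 / 10^6)"
proof
  have count: "real (card (binary_shrub_forests_321 n)) = shrub_count n 0" for n
    by (simp add: card_binary_shrub_forests_321 height_gf_shrub_words shrub_count_def)
  then have "H0 $ n = (shrub_step ^^ n) (1 :: real fps) $ 0" for n
    by (simp add: H0_def shrub_count_def)
  then show "(let x = (fps_X :: real fps) in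
           (4 * x^2 + 4 * x + 1)
         - (x^4 - 24 * x^3 + 8 * x^2 - 54 * x + 1) * H0^2
         + (15 * x^4 + 24 * x^3 - 71 * x^2 - 54 * x) * H0^4
         + (18 * x^5 - 215 * x^4 + 2 * x^3 - 360 * x^2) * H0^6
         + (3 * x^6 - 228 * x^5 - 213 * x^4 + 162 * x^3 + 729 * x^2) * H0^8
         - (138 * x^6 - 354 * x^5 - 1053 * x^4) * H0^10
         - (36 * x^7 - 751 * x^6 - 486 * x^5) * H0^12
         - (3 * x^8 - 420 * x^7 - 54 * x^6) * H0^14
         + 123 * x^8 * H0^16
         + 18 * x^9 * H0^18
         + x^10 * H0^20 = 0)"
    by (rule shrub_polynomial)
  show "(\<exists>r::real.
            (729 * r^4 - 28674 * r^3 - 15505 * r^2 - 25758 * r + 621 = 0 \<and>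
             (\<forall>t::real. 729 * t^4 - 28674 * t^3 - 15505 * t^2 - 25758 * t + 621 = 0 \<longrightarrow> t \<le> r)) \<and>
            (\<lambda>n. root n (real (card (binary_shrub_forests_321 n)))) \<longlonglongrightarrow> r \<and>
            \<bar>r - 39.88873\<bar> < 5 / 10^6)"
    unfolding count by (rule shrub_count_growth)
qed

end
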